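(* Let $\mathcal{H}$ have bounded first and second order derivatives: there are constants $M_1,M_2$ such that for all $x,x',v\in\mathbb{R}^{d_u}$, $\|\nabla\mathcal{H}(x)\|\le M_1$, $\|\mathcal{H}(x')-\mathcal{H}(x)\|\le M_1\|x'-x\|$ and $\|\nabla^2\mathcal{H}(x)[v,v]\|\le M_2\|v\|^2$. Let $(\{u_n^{(i)}\}_{i=1}^K)_{n\ge 0}$ be an EKI sequence with step-sizes $h_n=h_0n^{\beta}$ and inflation $\alpha_n^2=\alpha_0^2h_0^{-1}n^{2\gamma-\beta-2}$, where the parameters satisfy $\gamma-1\le\beta\le\gamma$ and $\gamma\in[0,1)$. Suppose that the mean sequence $(m_n)_{n\ge0}$ is bounded, and let $\ell(u)=\|\mathcal{G}(u)-y\|_\Gamma^2+\|u\|_\Sigma^2$. Then there is a constant $D$, independent of $\epsilon$, such that for any $\epsilon>0$ $$\min_{n\le N_\epsilon}\|\nabla\ell(m_n)\|\le\epsilon,$$ where the threshold iteration is $$N_\epsilon=\begin{cases}\exp(D/\epsilon^2) & \text{if }\gamma=0,\\[2pt] (D/\epsilon^2)^{\frac{2}{\min\{2\gamma,\ \beta+1-\gamma\}}} & \text{if }0<\gamma<1.\end{cases}$$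
   Context: Let $\mathcal{G}:\mathbb{R}^{d_u}\to\mathbb{R}^{d_y}$, $y\in\mathbb{R}^{d_y}$, and let $\Gamma\in\mathbb{R}^{d_y\times d_y}$, $\Sigma\in\mathbb{R}^{d_u\times d_u}$ be symmetric positive definite. Put $\mathcal{H}(u)=(\mathcal{G}(u),u)\in\mathbb{R}^{d_y+d_u}$, $z=(y,0)\in\mathbb{R}^{d_y+d_u}$, $\Gamma_+=\mathrm{diag}(\Gamma,\Sigma)$ (block diagonal). $\|\cdot\|$ is the Euclidean norm or the $l_2$-operator norm; for symmetric positive definite $A$, $\|v\|_A^2=v^TA^{-1}v$. Thus $\ell(u)=\|\mathcal{H}(u)-z\|_{\Gamma_+}^2$. For an ensemble $\{u_n^{(i)}\}_{i=1}^K\subset\mathbb{R}^{d_u}$ define $m_n=\frac1K\sum_i u_n^{(i)}$, $\overline{\mathcal{H}}_n=\frac1K\sum_i\mathcal{H}(u_n^{(i)})$, $C_n^{uu}=\frac1K\sum_i(u_n^{(i)}-m_n)(u_n^{(i)}-m_n)^T$, $C_n^{pp}=\frac1K\sum_i(\mathcal{H}(u_n^{(i)})-\overline{\mathcal{H}}_n)(\mathcal{H}(u_n^{(i)})-\overline{\mathcal{H}}_n)^T$, $C_n^{pu}=\frac1K\sum_i(\mathcal{H}(u_n^{(i)})-\overline{\mathcal{H}}_n)(u_n^{(i)}-m_n)^T$, $C_n^{up}=(C_n^{pu})^T$. An EKI (ensemble Kalman inversion) sequence with step-sizes $h_n>0$ and inflation parameters $\alpha_n>0$ is any sequence of ensembles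 (with fixed size $K$) such that for all $n\ge 0$ $$m_{n+1}=m_n+C_n^{up}(C_n^{pp}+h_n^{-1}\Gamma_+)^{-1}(z-\mathcal{H}(m_n)),$$ $$C_{n+1}^{uu}=C_n^{uu}-C_n^{up}(C_n^{pp}+h_n^{-1}\Gamma_+)^{-1}C_n^{pu}+\alpha_n^2\Sigma .$$ Convention: formulas for $h_n,\alpha_n$ in powers of $n$ are used for $n\ge 1$; the step $n=0$ uses the given constants $h_0,\alpha_0>0$.
   Formalization: The boundary β = γ−1 is excluded (γ−1 < β is assumed): for 0<γ<1 the exponent 2/min{2γ, β+1−γ} is then 2/0, and for γ=0, β=−1 the claim is false (e.g. G = sin, y = 1, Γ = Σ = 1, h_0 = 1, α_0 = 400, K = 4 with m_n = 0 for all n). *)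

theory Defs
  imports "HOL-Analysis.Analysis"
begin

text \<open>The space of pairs \<open>(a, b)\<close> with \<open>a\<close> of dimension \<open>CARD('y)\<close> and \<open>b\<close> of dimension
  \<open>CARD('u)\<close> is \<open>real ^ ('y + 'u)\<close>, so that block matrices are ordinary square matrices.\<close>

definition stack :: "real ^ 'y \<Rightarrow> real ^ 'u \<Rightarrow> real ^ ('y + 'u)" where
  "stack a b = (\<chi> i. case i of Inl p \<Rightarrow> a $ p | Inr q \<Rightarrow> b $ q)"

definition block_diag :: "real ^ 'y ^ 'y \<Rightarrow> real ^ 'u ^ 'u \<Rightarrow> real ^ ('y + 'u) ^ ('y + 'u)" where
  "block_diag A B = (\<chi> i j. case (i, j) of
      (Inl p, Inl q) \<Rightarrow> A $ p $ q
    | (Inr p, Inr q) \<Rightarrow> B $ p $ q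
    | _ \<Rightarrow> 0)"

definition sym_pos_def :: "real ^ 'n ^ 'n \<Rightarrow> bool" where
  "sym_pos_def A \<longleftrightarrow> transpose A = A \<and> (\<forall>v. v \<noteq> 0 \<longrightarrow> 0 < v \<bullet> (A *v v))"

text \<open>The squared norm \<open>\<parallel>v\<parallel>\<^sub>A\<^sup>2\<close>; note that it is weighted by the inverse of \<open>A\<close>.\<close>

definition sqnorm_wrt :: "real ^ 'n ^ 'n \<Rightarrow> real ^ 'n \<Rightarrow> real" where
  "sqnorm_wrt A v = v \<bullet> (matrix_inv A *v v)"

definition augmented :: "(real ^ 'u \<Rightarrow> real ^ 'y) \<Rightarrow> real ^ 'u \<Rightarrow> real ^ ('y + 'u)" where
  "augmented G u = stack (G u) u"

definition loss ::
    "(real ^ 'u \<Rightarrow> real ^ 'y) \<Rightarrow> real ^ 'y \<Rightarrow> real ^ 'y ^ 'y \<Rightarrow> real ^ 'u ^ 'u \<Rightarrow> real ^ 'u \<Rightarrow> real" where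
  "loss G y \<Gamma> \<Sigma> u = sqnorm_wrt \<Gamma> (G u - y) + sqnorm_wrt \<Sigma> u"

definition gradient :: "('a :: real_inner \<Rightarrow> real) \<Rightarrow> 'a \<Rightarrow> 'a" where
  "gradient f x = (THE D. GDERIV f x :> D)"

text \<open>The members of an ensemble of size \<open>K\<close> are indexed by \<open>{1..K}\<close>.\<close>

definition ens_mean :: "nat \<Rightarrow> (nat \<Rightarrow> real ^ 'n) \<Rightarrow> real ^ 'n" where
  "ens_mean K a = (1 / real K) *\<^sub>R (\<Sum>i=1..K. a i)"

text \<open>The matrix product of a column and a row is the outer product of the two vectors.\<close>

definition ens_cov :: "nat \<Rightarrow> (nat \<Rightarrow> real ^ 'm) \<Rightarrow> (nat \<Rightarrow> real ^ 'n) \<Rightarrow> real ^ 'n ^ 'm" where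
  "ens_cov K a b = (1 / real K) *\<^sub>R
     (\<Sum>i=1..K. (columnvector (a i - ens_mean K a) :: real ^ 1 ^ 'm) ** rowvector (b i - ens_mean K b))"

text \<open>\<open>u n i\<close> is the \<open>i\<close>-th member of the \<open>n\<close>-th ensemble. Only the mean and the covariance of the
  next ensemble are prescribed, not the individual members.\<close>

definition EKI_sequence ::
    "(real ^ 'u \<Rightarrow> real ^ 'y) \<Rightarrow> real ^ 'y \<Rightarrow> real ^ 'y ^ 'y \<Rightarrow> real ^ 'u ^ 'u \<Rightarrow> nat \<Rightarrow>
     (nat \<Rightarrow> real) \<Rightarrow> (nat \<Rightarrow> real) \<Rightarrow> (nat \<Rightarrow> nat \<Rightarrow> real ^ 'u) \<Rightarrow> bool" where
  "EKI_sequence G y \<Gamma> \<Sigma> K h \<alpha> u \<longleftrightarrow>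
     (\<forall>n. h n > 0) \<and> (\<forall>n. \<alpha> n > 0) \<and>
     (\<forall>n. let H = augmented G;
              p = (\<lambda>i. H (u n i));
              m = ens_mean K (u n);
              Cuu = ens_cov K (u n) (u n);
              Cpp = ens_cov K p p;
              Cpu = ens_cov K p (u n);
              Cup = transpose Cpu;
              gain = Cup ** matrix_inv (Cpp + (1 / h n) *\<^sub>R block_diag \<Gamma> \<Sigma>)
          in ens_mean K (u (Suc n)) = m + gain *v (stack y 0 - H m) \<and>
             ens_cov K (u (Suc n)) (u (Suc n)) = Cuu - gain ** Cpu + (\<alpha> n)\<^sup>2 *\<^sub>R \<Sigma>)"

text \<open>For \<open>\<gamma> \<noteq> 0\<close> the exponent is meaningful only if \<open>\<gamma> - 1 < \<beta>\<close>; at \<open>\<beta> = \<gamma> - 1\<close> its denominator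
  vanishes.\<close>

definition threshold_iteration :: "real \<Rightarrow> real \<Rightarrow> real \<Rightarrow> real \<Rightarrow> real" where
  "threshold_iteration \<beta> \<gamma> D \<epsilon> =
     (if \<gamma> = 0 then exp (D / \<epsilon>\<^sup>2)
      else (D / \<epsilon>\<^sup>2) powr (2 / min (2 * \<gamma>) (\<beta> + 1 - \<gamma>)))"

end

theory Submission
  imports Defs
begin

text \<open>
  Write \<open>p = \<gamma> - \<beta> - 1\<close>. The updated covariance before inflation is the minimum
  \<open>min\<^sub>L (1 - L) C (1 - L)\<^sup>T + L R L\<^sup>T\<close> over gains \<open>L\<close> (with \<open>R = \<Gamma>\<^sub>+/h\<close>, in the augmented space); scalar \<open>L\<close> give
  \<open>c \<mapsto> c / (1 + h\<^sub>n c) + \<alpha>\<^sub>n\<^sup>2\<close> for an upper bound \<open>C\<^sub>n \<le> c \<Sigma>\<close>, hence \<open>C\<^sub>n \<le> A n\<^sup>p \<Sigma>\<close>. Since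
  the ensemble size is fixed, every deviation is then \<open>O(\<tau>)\<close> with \<open>\<tau>\<^sup>2 \<sim> n\<^sup>p\<close>; the Lipschitz bound controls
  \<open>C\<^sup>p\<^sup>p\<close> and yields a matching lower bound \<open>C\<^sub>n \<ge> a n\<^sup>p \<Sigma>\<close>.

  Let \<open>J\<close> be the derivative of the augmented map at the mean, \<open>x = (C\<^sup>p\<^sup>p + \<Gamma>\<^sub>+/h)\<^sup>-\<^sup>1 (z - H(m))\<close> and
  \<open>w = J\<^sup>T x\<close>. Up to linearization errors of size \<open>h \<tau>\<^sup>3\<close> the mean moves by \<open>\<Delta> = C w\<close> and
  \<open>C\<^sup>p\<^sup>p x = J \<Delta>\<close>, so \<open>h \<nabla>\<ell>/2 = - w - h J\<^sup>T \<Gamma>\<^sub>+\<^sup>-\<^sup>1 J \<Delta>\<close>. Testing with \<open>\<Delta>\<close> makes the second term favourable, so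
  that only the linearization errors remain, and these are absorbed by Young's inequality:
  \<open>\<kappa> h \<tau>\<^sup>2 |\<nabla>\<ell>|\<^sup>2 \<le> \<ell>(m\<^sub>n) - \<ell>(m\<^sub>n\<^sub>+\<^sub>1) + E h \<tau>\<^sup>4\<close> as soon as \<open>h \<tau>\<^sup>2 \<sim> n\<^bsup>\<gamma>-1\<^esup>\<close> is small. Summing, with
  \<open>d = - p / 2\<close> and \<open>e = min \<gamma> d\<close>, the errors \<open>n\<^bsup>\<gamma>-1-2d\<^esup>\<close> contribute at most \<open>O(N\<^bsup>\<gamma>-e\<^esup>)\<close>
  against the total weight \<open>N\<^sup>\<gamma>\<close> (or \<open>ln N\<close> for \<open>\<gamma> = 0\<close>).
\<close>

section \<open>Symmetric positive definite matrices\<close>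

lemma matrix_inv_mult_vec:
  fixes A :: "real ^ 'n ^ 'n"
  assumes "invertible A"
  shows "A *v (matrix_inv A *v x) = x"
proof -
  have "A ** matrix_inv A = mat 1"
    using someI_ex[OF assms[unfolded invertible_def]] by (simp add: matrix_inv_def)
  then show ?thesis by (simp add: matrix_vector_mul_assoc)
qed

lemma matrix_inv_mult_vec_unique:
  fixes A :: "real ^ 'n ^ 'n"
  assumes "invertible A" and "A *v x = b"
  shows "matrix_inv A *v b = x"
proof -
  have "matrix_inv A ** A = mat 1"
    using someI_ex[OF assms(1)[unfolded invertible_def]] by (simp add: matrix_inv_def)
  then show ?thesis
    using assms(2) by (metis matrix_vector_mul_assoc matrix_vector_mul_lid)
qed

lemma sym_pos_def_symmetric:
  assumes "sym_pos_def A"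
  shows "x \<bullet> (A *v y) = (A *v x) \<bullet> y"
  using assms unfolding sym_pos_def_def
  by (metis dot_lmul_matrix transpose_matrix_vector)

lemma sym_pos_def_nonneg: "sym_pos_def A \<Longrightarrow> 0 \<le> v \<bullet> (A *v v)"
  unfolding sym_pos_def_def by (metis inner_zero_left less_eq_real_def)

lemma sym_pos_def_invertible:
  fixes A :: "real ^ 'n ^ 'n"
  assumes "sym_pos_def A"
  shows "invertible A"
proof -
  have "\<forall>x. A *v x = 0 \<longrightarrow> x = 0"
    using assms unfolding sym_pos_def_def by (metis inner_zero_right less_irrefl)
  then show ?thesis
    by (simp add: invertible_left_inverse matrix_left_invertible_ker)
qed

lemma sym_pos_def_matrix_inv_symmetric:
  fixes A :: "real ^ 'n ^ 'n"
  assumes "sym_pos_def A"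
  shows "x \<bullet> (matrix_inv A *v y) = (matrix_inv A *v x) \<bullet> y"
  using sym_pos_def_symmetric[OF assms, of "matrix_inv A *v x" "matrix_inv A *v y"]
  by (simp add: matrix_inv_mult_vec[OF sym_pos_def_invertible[OF assms]])

lemma sqnorm_wrt_nonneg:
  assumes "sym_pos_def A"
  shows "0 \<le> sqnorm_wrt A v"
  using sym_pos_def_nonneg[OF assms, of "matrix_inv A *v v"]
  by (simp add: sqnorm_wrt_def matrix_inv_mult_vec[OF sym_pos_def_invertible[OF assms]] inner_commute)

text \<open>The quadratic form is continuous and positive on the compact unit sphere, so it attains
  a positive minimum there; homogeneity carries this minimum to all vectors.\<close>

lemma sym_pos_def_coercive:
  fixes A :: "real ^ 'n ^ 'n"
  assumes "sym_pos_def A"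
  obtains \<sigma> where "\<sigma> > 0" and "\<And>v. \<sigma> * (norm v)\<^sup>2 \<le> v \<bullet> (A *v v)"
proof -
  have "continuous_on (sphere 0 1) (\<lambda>v. v \<bullet> (A *v v))"
    by (intro continuous_intros linear_continuous_on matrix_vector_mul_bounded_linear)
  moreover have "sphere (0 :: real ^ 'n) 1 \<noteq> {}"
    by simp
  ultimately obtain w where w: "w \<in> sphere 0 1"
      "\<And>v. v \<in> sphere 0 1 \<Longrightarrow> w \<bullet> (A *v w) \<le> v \<bullet> (A *v v)"
    using continuous_attains_inf[OF compact_sphere] by blast
  have pos: "w \<bullet> (A *v w) > 0"
  proof -
    have "w \<noteq> 0"
      using w(1) by auto
    then show ?thesis
      using assms by (simp add: sym_pos_def_def)
  qed
  have "w \<bullet> (A *v w) * (norm v)\<^sup>2 \<le> v \<bullet> (A *v v)" for v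
  proof (cases "v = 0")
    case False
    define s where "s = inverse (norm v) *\<^sub>R v"
    have v: "v = norm v *\<^sub>R s" and s: "s \<in> sphere 0 1"
      using False by (auto simp: s_def)
    have "v \<bullet> (A *v v) = (norm v)\<^sup>2 * (s \<bullet> (A *v s))"
      by (subst v, subst (2) v) (simp add: matrix_vector_mult_scaleR power2_eq_square)
    then show ?thesis
      using mult_left_mono[OF w(2)[OF s], of "(norm v)\<^sup>2"] by (simp add: mult.commute)
  qed simp
  with pos show thesis using that by blast
qed

lemma matrix_mult_vec_bounded:
  fixes A :: "real ^ 'n ^ 'm"
  obtains c where "c > 0" and "\<And>v. norm (A *v v) \<le> c * norm v"
  using bounded_linear.pos_bounded[OF matrix_vector_mul_bounded_linear[of A]]
  by (metis mult.commute)

section \<open>Stacked vectors and block-diagonal matrices\<close>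

lemma sum_UNIV_Plus:
  fixes f :: "'y::finite + 'u::finite \<Rightarrow> real"
  shows "sum f UNIV = (\<Sum>p\<in>UNIV. f (Inl p)) + (\<Sum>q\<in>UNIV. f (Inr q))"
  using sum.Plus[of "UNIV :: 'y set" "UNIV :: 'u set" f] by (simp add: UNIV_Plus_UNIV)

lemma inner_stack: "stack a b \<bullet> stack c d = a \<bullet> c + b \<bullet> d"
  by (simp add: inner_vec_def sum_UNIV_Plus stack_def)

lemma stack_decompose: "\<exists>a b. v = stack a b"
proof -
  have "v = stack (\<chi> p. v $ Inl p) (\<chi> q. v $ Inr q)"
    by (auto simp: stack_def vec_eq_iff split: sum.split)
  then show ?thesis by blast
qed

lemma stack_diff: "stack a b - stack c d = stack (a - c) (b - d)"
  by (auto simp: stack_def vec_eq_iff split: sum.split)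

lemma block_diag_mult_stack: "block_diag A B *v stack a b = stack (A *v a) (B *v b)"
  by (auto simp: block_diag_def stack_def vec_eq_iff matrix_vector_mult_def sum_UNIV_Plus
      split: sum.split)

lemma sym_pos_def_block_diag:
  assumes "sym_pos_def A" and "sym_pos_def B"
  shows "sym_pos_def (block_diag A B)"
  unfolding sym_pos_def_def
proof safe
  have "A $ i $ j = A $ j $ i" "B $ k $ l = B $ l $ k" for i j k l
    using assms unfolding sym_pos_def_def transpose_def by (metis vec_lambda_beta)+
  then show "transpose (block_diag A B) = block_diag A B"
    by (auto simp: transpose_def block_diag_def vec_eq_iff split: sum.split)
next
  fix v :: "real ^ ('a + 'b)"
  assume "v \<noteq> 0"
  obtain a b where v: "v = stack a b"
    using stack_decompose by blast
  have "a \<noteq> 0 \<or> b \<noteq> 0"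
  proof (rule ccontr)
    assume "\<not> ?thesis"
    then have "v = 0"
      unfolding v by (auto simp: stack_def vec_eq_iff split: sum.split)
    with \<open>v \<noteq> 0\<close> show False ..
  qed
  then show "0 < v \<bullet> (block_diag A B *v v)"
    using assms sym_pos_def_nonneg[OF assms(1), of a] sym_pos_def_nonneg[OF assms(2), of b]
    unfolding v block_diag_mult_stack inner_stack sym_pos_def_def
    by (metis add_pos_nonneg add_nonneg_pos)
qed

text \<open>The inverse of a block-diagonal matrix acts blockwise. The regularizer thus becomes part
  of a single least-squares residual, and later estimates refer only to the augmented map.\<close>

lemma loss_eq_sqnorm_augmented:
  assumes "sym_pos_def \<Gamma>" and "sym_pos_def \<Sigma>"
  shows "loss G y \<Gamma> \<Sigma> u = sqnorm_wrt (block_diag \<Gamma> \<Sigma>) (augmented G u - stack y 0)"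
proof -
  have "matrix_inv (block_diag \<Gamma> \<Sigma>) *v stack a b = stack (matrix_inv \<Gamma> *v a) (matrix_inv \<Sigma> *v b)"
    for a b
    by (rule matrix_inv_mult_vec_unique)
      (simp_all add: sym_pos_def_invertible sym_pos_def_block_diag assms block_diag_mult_stack
        matrix_inv_mult_vec)
  then show ?thesis
    by (simp add: loss_def sqnorm_wrt_def augmented_def stack_diff inner_stack)
qed

section \<open>Ensemble covariances\<close>

definition deviation :: "nat \<Rightarrow> (nat \<Rightarrow> real ^ 'n) \<Rightarrow> nat \<Rightarrow> real ^ 'n" where
  "deviation K a i = a i - ens_mean K a"

lemma outer_product_mult_vec:
  fixes a :: "real ^ 'm" and b w :: "real ^ 'n"
  shows "((columnvector a :: real ^ 1 ^ 'm) ** rowvector b) *v w = (b \<bullet> w) *\<^sub>R a"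
  by (simp add: vec_eq_iff matrix_vector_mult_def matrix_matrix_mult_def columnvector_def
      rowvector_def inner_vec_def sum_distrib_right sum_distrib_left mult_ac)

lemma sum_matrix_mult_vec:
  fixes F :: "'i \<Rightarrow> real ^ 'n ^ 'm"
  shows "(\<Sum>i\<in>I. F i) *v w = (\<Sum>i\<in>I. F i *v w)"
  by (induction I rule: infinite_finite_induct) (auto simp: matrix_vector_mult_add_rdistrib)

lemma ens_cov_mult_vec:
  "ens_cov K a b *v w = (1 / real K) *\<^sub>R (\<Sum>i=1..K. (deviation K b i \<bullet> w) *\<^sub>R deviation K a i)"
  by (simp add: ens_cov_def sum_matrix_mult_vec outer_product_mult_vec deviation_def
      flip: scaleR_matrix_vector_assoc)

lemma inner_ens_cov:
  "v \<bullet> (ens_cov K a b *v w) = (1 / real K) * (\<Sum>i=1..K. (deviation K b i \<bullet> w) * (deviation K a i \<bullet> v))"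
  by (simp add: ens_cov_mult_vec inner_sum_right inner_commute)

lemma inner_ens_cov_commute: "v \<bullet> (ens_cov K a b *v w) = w \<bullet> (ens_cov K b a *v v)"
  by (simp add: inner_ens_cov mult.commute)

lemma transpose_ens_cov: "transpose (ens_cov K a b) = ens_cov K b a"
proof -
  have "transpose (ens_cov K a b) *v v = ens_cov K b a *v v" for v
    by (metis (no_types, lifting) dot_lmul_matrix inner_commute inner_ens_cov_commute
        transpose_matrix_vector vector_eq_rdot)
  then show ?thesis by (simp add: matrix_eq)
qed

lemma ens_cov_nonneg: "0 \<le> v \<bullet> (ens_cov K a a *v v)"
  by (auto simp: inner_ens_cov intro!: sum_nonneg divide_nonneg_nonneg)

lemma sum_deviation:
  assumes "K \<ge> 1"
  shows "(\<Sum>i=1..K. deviation K a i) = 0"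
  using assms by (simp add: deviation_def sum_subtractf ens_mean_def sum_constant_scaleR del: sum_constant)

lemma norm_ens_average_le:
  fixes f :: "nat \<Rightarrow> 'b::real_normed_vector"
  assumes "K \<ge> 1" and "\<And>i. i \<in> {1..K} \<Longrightarrow> norm (f i) \<le> c"
  shows "norm ((1 / real K) *\<^sub>R (\<Sum>i=1..K. f i)) \<le> c"
proof -
  have "norm (\<Sum>i=1..K. f i) \<le> real K * c"
    using sum_norm_bound[of "{1..K}" f c] assms(2) by simp
  then show ?thesis
    using assms(1) by (simp add: field_simps)
qed

text \<open>\<open>b \<bullet> A\<^sup>-\<^sup>1 b\<close> is the maximum over \<open>w\<close> of the left-hand side.\<close>

lemma inner_matrix_inv_ge:
  assumes "sym_pos_def A"
  shows "2 * (w \<bullet> b) - w \<bullet> (A *v w) \<le> b \<bullet> (matrix_inv A *v b)"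
proof -
  define x where "x = matrix_inv A *v b"
  have b: "A *v x = b"
    by (simp add: x_def matrix_inv_mult_vec sym_pos_def_invertible assms)
  have "0 \<le> (x - w) \<bullet> (A *v (x - w))"
    by (rule sym_pos_def_nonneg[OF assms])
  also have "\<dots> = x \<bullet> b - 2 * (w \<bullet> b) + w \<bullet> (A *v w)"
    using sym_pos_def_symmetric[OF assms, of x w]
    by (simp add: matrix_vector_mult_diff_distrib inner_diff_left inner_diff_right b inner_commute)
  finally show ?thesis
    by (simp add: x_def inner_commute)
qed

lemma sym_pos_def_add_scaled:
  assumes S: "transpose S = S" "\<And>v. 0 \<le> v \<bullet> (S *v v)" and B: "sym_pos_def B" and c: "c > 0"
  shows "sym_pos_def (S + c *\<^sub>R B)"
  unfolding sym_pos_def_def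
proof safe
  have "S $ i $ j = S $ j $ i" "B $ i $ j = B $ j $ i" for i j
    using S(1) B unfolding sym_pos_def_def transpose_def by (metis vec_lambda_beta)+
  then show "transpose (S + c *\<^sub>R B) = S + c *\<^sub>R B"
    by (auto simp: transpose_def vec_eq_iff)
next
  fix v assume "v \<noteq> (0 :: real ^ 'a)"
  then have "0 < c * (v \<bullet> (B *v v))"
    using B c by (simp add: sym_pos_def_def)
  then show "0 < v \<bullet> ((S + c *\<^sub>R B) *v v)"
    using S(2)[of v]
    by (simp add: matrix_vector_mult_add_rdistrib inner_add_right flip: scaleR_matrix_vector_assoc)
qed

text \<open>On a vector v with S v = t c B v, the matrix S (S + c B)^-1 S acts as t/(1+t) times S,
  and t \<le> l. Simultaneous diagonalization is replaced by testing the positivity of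
  \<open>S\<close> on one vector.\<close>

lemma inner_matrix_inv_le:
  assumes S: "transpose S = S" "\<And>v. 0 \<le> v \<bullet> (S *v v)" and B: "sym_pos_def B" and c: "c > 0"
    and l: "l > 0" "\<And>x. x \<bullet> (S *v x) \<le> l * (c * (x \<bullet> (B *v x)))"
  shows "(S *v w) \<bullet> (matrix_inv (S + c *\<^sub>R B) *v (S *v w)) \<le> l / (1 + l) * (w \<bullet> (S *v w))"
proof -
  define x where "x = matrix_inv (S + c *\<^sub>R B) *v (S *v w)"
  define \<theta> where "\<theta> = (1 + l) / l"
  have th: "\<theta> > 0"
    using l(1) by (simp add: \<theta>_def)
  have "(S + c *\<^sub>R B) *v x = S *v w"
    by (simp add: x_def matrix_inv_mult_vec sym_pos_def_invertible sym_pos_def_add_scaled assms)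
  then have "x \<bullet> (S *v w) = x \<bullet> (S *v x) + c * (x \<bullet> (B *v x))"
    by (metis inner_add_right inner_scaleR_right matrix_vector_mult_add_rdistrib scaleR_matrix_vector_assoc)
  \<comment> \<open>By \<open>l\<close> the term c (x \<bullet> B x) is at least (x \<bullet> S x) /
    l, so the sum is at least (1 + 1/l) (x \<bullet> S x).\<close>
  with l have xS: "\<theta> * (x \<bullet> (S *v x)) \<le> x \<bullet> (S *v w)"
    by (simp add: \<theta>_def field_simps)
  have sym: "w \<bullet> (S *v x) = x \<bullet> (S *v w)"
    using S(1) by (metis dot_lmul_matrix inner_commute transpose_matrix_vector)
  \<comment> \<open>The factor \<theta> is chosen so that \<open>xS\<close> bounds the quadratic
    term of this expansion by half of the mixed term.\<close>
  have "0 \<le> (w - \<theta> *\<^sub>R x) \<bullet> (S *v (w - \<theta> *\<^sub>R x))"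
    by (rule S(2))
  also have "\<dots> = w \<bullet> (S *v w) - 2 * \<theta> * (x \<bullet> (S *v w)) + \<theta> * (\<theta> * (x \<bullet> (S *v x)))"
    by (simp add: matrix_vector_mult_diff_distrib matrix_vector_mult_scaleR inner_diff_left
        inner_diff_right sym algebra_simps)
  also have "\<dots> \<le> w \<bullet> (S *v w) - \<theta> * (x \<bullet> (S *v w))"
    using mult_left_mono[OF xS, of \<theta>] th by linarith
  finally have "x \<bullet> (S *v w) \<le> (w \<bullet> (S *v w)) / \<theta>"
    using th by (simp add: field_simps)
  then show ?thesis
    by (simp add: x_def \<theta>_def inner_commute mult.commute)
qed

text \<open>The centre \<open>q\<close> is free: the mean lies within \<open>c\<close> of it as
  well, whence the factor 2. It is applied with the value of the augmented map at the ensemble mean,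
  which in general is not the mean of the mapped ensemble.\<close>

lemma norm_deviation_le:
  assumes K: "K \<ge> 1" and i: "i \<in> {1..K}" and c: "\<And>i. i \<in> {1..K} \<Longrightarrow> norm (a i - q) \<le> c"
  shows "norm (deviation K a i) \<le> 2 * c"
proof -
  have "(1 / real K) *\<^sub>R (\<Sum>j=1..K. a j - q) = ens_mean K a - q"
    using K by (simp add: ens_mean_def sum_subtractf sum_constant_scaleR scaleR_diff_right del: sum_constant)
  then have "norm (ens_mean K a - q) \<le> c"
    using norm_ens_average_le[of K "\<lambda>j. a j - q" c] K c by simp
  moreover have "deviation K a i = (a i - q) - (ens_mean K a - q)"
    by (simp add: deviation_def)
  ultimately show ?thesis
    using c[OF i] norm_triangle_ineq4[of "a i - q" "ens_mean K a - q"] by simp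
qed

text \<open>Deviations sum to zero, hence so do their images under \<open>J\<close>, and subtracting
  these leaves the mean of \<open>a\<close> unchanged. This allows the linearization error to be
  recentred.\<close>

lemma deviation_diff_linear:
  assumes K: "K \<ge> 1" and J: "linear J"
  shows "deviation K (\<lambda>j. a j - J (deviation K b j)) i = deviation K a i - J (deviation K b i)"
proof -
  have "(\<Sum>j=1..K. J (deviation K b j)) = 0"
    using sum_deviation[OF K, of b] linear_sum[OF J, of "deviation K b" "{1..K}"] linear_0[OF J] by simp
  then show ?thesis
    by (simp add: deviation_def ens_mean_def sum_subtractf)
qed

text \<open>Testing the covariance with a deviation d itself leaves |d|^4 as one of \<open>K\<close>
  nonnegative summands, so |d|^4 \<le> K c |d|^2. A covariance bound thus controls every single
  member, at the price of a factor \<open>K\<close>.\<close>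

lemma norm_deviation_le_ens_cov:
  assumes K: "K \<ge> 1" and i: "i \<in> {1..K}" and c: "\<And>v. v \<bullet> (ens_cov K a a *v v) \<le> c * (norm v)\<^sup>2"
  shows "norm (deviation K a i) \<le> sqrt (real K * c)"
proof -
  let ?d = "deviation K a i"
  have "(norm ?d)\<^sup>2 * (norm ?d)\<^sup>2 = (?d \<bullet> ?d) * (?d \<bullet> ?d)"
    by (simp add: dot_square_norm)
  also have "\<dots> \<le> (\<Sum>j=1..K. (deviation K a j \<bullet> ?d) * (deviation K a j \<bullet> ?d))"
    using i by (intro member_le_sum) auto
  also have "\<dots> = real K * (?d \<bullet> (ens_cov K a a *v ?d))"
    using K by (simp add: inner_ens_cov)
  also have "\<dots> \<le> (real K * c) * (norm ?d)\<^sup>2"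
    using mult_left_mono[OF c[of ?d], of "real K"] by simp
  finally have "(norm ?d)\<^sup>2 \<le> real K * c \<or> ?d = 0"
    by (metis mult_right_le_imp_le norm_eq_zero zero_less_power2)
  \<comment> \<open>The hypothesis at a unit vector gives c \<ge> 0, which settles the case of a
    zero deviation.\<close>
  moreover have "0 \<le> real K * c"
    using order_trans[OF ens_cov_nonneg c[of "axis undefined 1"]] by (simp add: norm_axis_1)
  ultimately show ?thesis
    using real_le_rsqrt by (metis norm_zero real_sqrt_ge_zero)
qed

lemma inner_ens_cov_le:
  assumes K: "K \<ge> 1" and c: "\<And>i. i \<in> {1..K} \<Longrightarrow> norm (deviation K a i) \<le> c"
  shows "v \<bullet> (ens_cov K a a *v v) \<le> c\<^sup>2 * (norm v)\<^sup>2"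
proof -
  have "(deviation K a i \<bullet> v) * (deviation K a i \<bullet> v) \<le> c\<^sup>2 * (norm v)\<^sup>2" if "i \<in> {1..K}" for i
  proof -
    have "\<bar>deviation K a i \<bullet> v\<bar> \<le> c * norm v"
      using Cauchy_Schwarz_ineq2[of "deviation K a i" v] mult_right_mono[OF c[OF that], of "norm v"] by simp
    then have "\<bar>deviation K a i \<bullet> v\<bar>\<^sup>2 \<le> (c * norm v)\<^sup>2"
      by (intro power_mono) auto
    then show ?thesis
      by (simp add: power2_eq_square mult_ac)
  qed
  then have "(\<Sum>i=1..K. (deviation K a i \<bullet> v) * (deviation K a i \<bullet> v)) \<le> real K * (c\<^sup>2 * (norm v)\<^sup>2)"
    using sum_bounded_above[of "{1..K}" "\<lambda>i. (deviation K a i \<bullet> v) * (deviation K a i \<bullet> v)"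
        "c\<^sup>2 * (norm v)\<^sup>2"] by simp
  then show ?thesis
    using K by (simp add: inner_ens_cov field_simps)
qed

text \<open>The second block of the augmented map is the identity, so vectors with vanishing data
  block see only the ensemble itself. On such vectors C^pp reduces to C^pu; both covariance bounds
  rest on this.\<close>

lemma deviation_augmented_inner_stack:
  "deviation K (\<lambda>i. augmented G (a i)) i \<bullet> stack 0 v = deviation K a i \<bullet> v"
  by (simp add: deviation_def ens_mean_def inner_diff_left inner_sum_left augmented_def inner_stack)

lemma ens_cov_augmented_mult_stack:
  "ens_cov K b (\<lambda>i. augmented G (a i)) *v stack 0 v = ens_cov K b a *v v"
  by (simp add: ens_cov_mult_vec deviation_augmented_inner_stack)

section \<open>One step of the covariance recursion\<close>

definition innovation_cov ::
    "(real ^ 'u \<Rightarrow> real ^ 'y) \<Rightarrow> real ^ ('y + 'u) ^ ('y + 'u) \<Rightarrow> nat \<Rightarrow> real \<Rightarrow> (nat \<Rightarrow> real ^ 'u) \<Rightarrow>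
     real ^ ('y + 'u) ^ ('y + 'u)" where
  "innovation_cov G B K h a =
     ens_cov K (\<lambda>i. augmented G (a i)) (\<lambda>i. augmented G (a i)) + (1 / h) *\<^sub>R B"

lemma sym_pos_def_innovation_cov:
  assumes "sym_pos_def B" and "h > 0"
  shows "sym_pos_def (innovation_cov G B K h a)"
  unfolding innovation_cov_def using assms
  by (intro sym_pos_def_add_scaled) (auto simp: transpose_ens_cov ens_cov_nonneg)

lemma EKI_mean_update:
  assumes "EKI_sequence G y \<Gamma> \<Sigma> K h \<alpha> u"
  shows "ens_mean K (u (Suc n)) = ens_mean K (u n) +
    ens_cov K (u n) (\<lambda>i. augmented G (u n i)) *v
      (matrix_inv (innovation_cov G (block_diag \<Gamma> \<Sigma>) K (h n) (u n)) *v
        (stack y 0 - augmented G (ens_mean K (u n))))"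
  using assms unfolding EKI_sequence_def Let_def innovation_cov_def
  by (simp add: transpose_ens_cov flip: matrix_vector_mul_assoc)

lemma EKI_cov_update:
  fixes u :: "nat \<Rightarrow> nat \<Rightarrow> real ^ 'u"
  assumes "EKI_sequence G y \<Gamma> \<Sigma> K h \<alpha> u"
  defines "b \<equiv> \<lambda>n v. ens_cov K (\<lambda>i. augmented G (u n i)) (u n) *v v"
  shows "v \<bullet> (ens_cov K (u (Suc n)) (u (Suc n)) *v v) = v \<bullet> (ens_cov K (u n) (u n) *v v)
    - b n v \<bullet> (matrix_inv (innovation_cov G (block_diag \<Gamma> \<Sigma>) K (h n) (u n)) *v b n v)
    + (\<alpha> n)\<^sup>2 * (v \<bullet> (\<Sigma> *v v))"
proof -
  \<comment> \<open>As C^up is the transpose of C^pu, the subtracted term becomes a quadratic form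
    of the inverse, to which the bounds above apply.\<close>
  have "v \<bullet> (ens_cov K (u n) (\<lambda>i. augmented G (u n i)) *v x) = b n v \<bullet> x" for x
    by (simp add: b_def inner_ens_cov_commute[of v] inner_commute)
  then show ?thesis
    using assms(1) unfolding EKI_sequence_def Let_def innovation_cov_def
    by (simp add: transpose_ens_cov matrix_vector_mult_add_rdistrib matrix_vector_mult_diff_rdistrib
        inner_add_right inner_diff_right b_def flip: matrix_vector_mul_assoc scaleR_matrix_vector_assoc)
qed

text \<open>The subtracted form is bounded below by testing with \<kappa> (0, v). This amounts to a
  scalar gain and leaves (1 - \<kappa>)^2 C + (\<kappa>^2 / h) \<Sigma>.\<close>

lemma EKI_cov_upper:
  fixes G :: "real ^ 'u \<Rightarrow> real ^ 'y" and u :: "nat \<Rightarrow> nat \<Rightarrow> real ^ 'u"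
  assumes EKI: "EKI_sequence G y \<Gamma> \<Sigma> K h \<alpha> u" and pd: "sym_pos_def \<Gamma>" "sym_pos_def \<Sigma>"
    and c: "0 \<le> c" "\<And>v. v \<bullet> (ens_cov K (u n) (u n) *v v) \<le> c * (v \<bullet> (\<Sigma> *v v))"
  shows "v \<bullet> (ens_cov K (u (Suc n)) (u (Suc n)) *v v) \<le> (c / (1 + h n * c) + (\<alpha> n)\<^sup>2) * (v \<bullet> (\<Sigma> *v v))"
proof -
  have h: "h n > 0"
    using EKI by (simp add: EKI_sequence_def)
  let ?A = "innovation_cov G (block_diag \<Gamma> \<Sigma>) K (h n) (u n)"
  define b where "b = ens_cov K (\<lambda>i. augmented G (u n i)) (u n) *v v"
  define w where "w = stack (0 :: real ^ 'y) v"
  \<comment> \<open>The minimizer of (1 - \<kappa>)^2 c + \<kappa>^2 / h, with minimum c / (1 + h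
    c).\<close>
  define \<kappa> where "\<kappa> = h n * c / (1 + h n * c)"
  define C where "C = v \<bullet> (ens_cov K (u n) (u n) *v v)"
  define s where "s = v \<bullet> (\<Sigma> *v v)"
  have pos: "1 + h n * c > 0"
    using h c(1) by (simp add: add_pos_nonneg)
  have wb: "w \<bullet> b = C"
    unfolding w_def b_def C_def
    by (rule trans[OF inner_ens_cov_commute]) (simp add: ens_cov_augmented_mult_stack)
  have wAw: "w \<bullet> (?A *v w) = C + s / h n"
    using wb unfolding innovation_cov_def
    by (simp add: matrix_vector_mult_add_rdistrib inner_add_right w_def b_def s_def
        ens_cov_augmented_mult_stack block_diag_mult_stack inner_stack flip: scaleR_matrix_vector_assoc)
  have "2 * ((\<kappa> *\<^sub>R w) \<bullet> b) - (\<kappa> *\<^sub>R w) \<bullet> (?A *v (\<kappa> *\<^sub>R w)) \<le> b \<bullet> (matrix_inv ?A *v b)"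
    by (intro inner_matrix_inv_ge sym_pos_def_innovation_cov sym_pos_def_block_diag pd h)
  then have "2 * \<kappa> * C - \<kappa>\<^sup>2 * (C + s / h n) \<le> b \<bullet> (matrix_inv ?A *v b)"
    by (simp add: matrix_vector_mult_scaleR wb wAw power2_eq_square)
  then have "v \<bullet> (ens_cov K (u (Suc n)) (u (Suc n)) *v v)
      \<le> C - (2 * \<kappa> * C - \<kappa>\<^sup>2 * (C + s / h n)) + (\<alpha> n)\<^sup>2 * s"
    unfolding EKI_cov_update[OF EKI] by (simp add: b_def C_def s_def)
  also have "\<dots> = (1 - \<kappa>)\<^sup>2 * C + \<kappa>\<^sup>2 / h n * s + (\<alpha> n)\<^sup>2 * s"
    by (simp add: power2_eq_square algebra_simps)
  also have "\<dots> \<le> (1 - \<kappa>)\<^sup>2 * (c * s) + \<kappa>\<^sup>2 / h n * s + (\<alpha> n)\<^sup>2 * s"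
    using c(2)[of v] by (intro add_right_mono mult_left_mono) (auto simp: C_def s_def)
  also have "\<dots> = (((1 - \<kappa>)\<^sup>2 * c + \<kappa>\<^sup>2 / h n) + (\<alpha> n)\<^sup>2) * s"
    by (simp add: algebra_simps)
  also have "(1 - \<kappa>)\<^sup>2 * c + \<kappa>\<^sup>2 / h n = c / (1 + h n * c)"
  proof -
    have 1: "1 - \<kappa> = 1 / (1 + h n * c)"
      using pos by (simp add: \<kappa>_def field_simps)
    have "(1 - \<kappa>)\<^sup>2 * c + \<kappa>\<^sup>2 / h n = c * (1 + h n * c) / (1 + h n * c)\<^sup>2"
    proof -
      have "\<kappa>\<^sup>2 / h n = h n * c\<^sup>2 / (1 + h n * c)\<^sup>2"
        using h by (simp add: \<kappa>_def power_divide power_mult_distrib power2_eq_square)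
      moreover have "c * (1 + h n * c) = c + h n * c\<^sup>2"
        by (simp add: power2_eq_square algebra_simps)
      ultimately show ?thesis
        unfolding 1 by (simp add: power_divide add_divide_distrib)
    qed
    then show ?thesis
      using pos by (simp add: power2_eq_square)
  qed
  finally show ?thesis
    by (simp add: s_def)
qed

text \<open>For w = (0, v) the vector C^pu v equals C^pp w, so the subtracted term has the form
  treated in \<open>inner_matrix_inv_le\<close>, with factor 1/h and l = h s. At least the fraction
  1 / (1 + h s) of the covariance survives.\<close>

lemma EKI_cov_lower:
  fixes G :: "real ^ 'u \<Rightarrow> real ^ 'y" and u :: "nat \<Rightarrow> nat \<Rightarrow> real ^ 'u"
  assumes EKI: "EKI_sequence G y \<Gamma> \<Sigma> K h \<alpha> u" and pd: "sym_pos_def \<Gamma>" "sym_pos_def \<Sigma>"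
    and s: "0 < s" "\<And>x. x \<bullet> (ens_cov K (\<lambda>i. augmented G (u n i)) (\<lambda>i. augmented G (u n i)) *v x)
              \<le> s * (x \<bullet> (block_diag \<Gamma> \<Sigma> *v x))"
  shows "1 / (1 + h n * s) * (v \<bullet> (ens_cov K (u n) (u n) *v v)) + (\<alpha> n)\<^sup>2 * (v \<bullet> (\<Sigma> *v v))
    \<le> v \<bullet> (ens_cov K (u (Suc n)) (u (Suc n)) *v v)"
proof -
  have h: "h n > 0"
    using EKI by (simp add: EKI_sequence_def)
  let ?S = "ens_cov K (\<lambda>i. augmented G (u n i)) (\<lambda>i. augmented G (u n i))"
  define w where "w = stack (0 :: real ^ 'y) v"
  define C where "C = v \<bullet> (ens_cov K (u n) (u n) *v v)"
  have Sw: "?S *v w = ens_cov K (\<lambda>i. augmented G (u n i)) (u n) *v v"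
    by (simp add: w_def ens_cov_augmented_mult_stack)
  have wSw: "w \<bullet> (?S *v w) = C"
    unfolding Sw C_def
    by (rule trans[OF inner_ens_cov_commute]) (simp add: w_def ens_cov_augmented_mult_stack)
  have "(?S *v w) \<bullet> (matrix_inv (innovation_cov G (block_diag \<Gamma> \<Sigma>) K (h n) (u n)) *v (?S *v w))
      \<le> (h n * s) / (1 + h n * s) * (w \<bullet> (?S *v w))"
    unfolding innovation_cov_def
    by (rule inner_matrix_inv_le)
      (use h s in \<open>auto simp: transpose_ens_cov ens_cov_nonneg sym_pos_def_block_diag pd\<close>)
  moreover have "1 / (1 + h n * s) * C = C - (h n * s) / (1 + h n * s) * C"
    using h s(1) by (simp add: field_simps add_nonneg_eq_0_iff)
  ultimately show ?thesis
    unfolding EKI_cov_update[OF EKI] wSw unfolding Sw by (simp add: C_def)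
qed

section \<open>Descent of the loss in one step\<close>

text \<open>The mean value inequality is applied twice along the segment. Only second derivatives
  with both arguments proportional to \<open>v\<close> occur, so a bound on the diagonal suffices;
  the factor 1/2 of Taylor's formula is given up.\<close>

lemma norm_second_order_remainder_le:
  fixes f :: "'a::real_normed_vector \<Rightarrow> 'b::real_normed_vector"
    and f' :: "'a \<Rightarrow> 'a \<Rightarrow>\<^sub>L 'b"
  assumes f: "\<And>x. (f has_derivative blinfun_apply (f' x)) (at x)"
    and f': "\<And>x. (f' has_derivative blinfun_apply (f'' x)) (at x)"
    and M: "\<And>x v. norm (blinfun_apply (blinfun_apply (f'' x) v) v) \<le> M * (norm v)\<^sup>2"
  shows "norm (f (x + v) - f x - blinfun_apply (f' x) v) \<le> M * (norm v)\<^sup>2"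
proof -
  \<comment> \<open>The directional derivative along the segment; the second derivative controls its
    change.\<close>
  define \<psi> where "\<psi> t = blinfun_apply (f' (x + t *\<^sub>R v)) v" for t
  have psi: "(\<psi> has_vector_derivative blinfun_apply (blinfun_apply (f'' (x + t *\<^sub>R v)) v) v)
      (at t within S)" for t S
  proof -
    have "((\<lambda>t. f' (x + t *\<^sub>R v)) has_derivative (\<lambda>s. blinfun_apply (f'' (x + t *\<^sub>R v)) (s *\<^sub>R v))) (at t within S)"
      by (rule has_derivative_compose[OF _ f']) (auto intro!: derivative_eq_intros)
    from bounded_linear.has_derivative[OF blinfun.bounded_linear_left[of v] this]
    show ?thesis
      unfolding has_vector_derivative_def \<psi>_def
      by (simp add: blinfun.scaleR_right blinfun.scaleR_left)
  qed
  have M0: "0 \<le> M * (norm v)\<^sup>2"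
    using order_trans[OF norm_ge_zero M] .
  have psi_le: "norm (\<psi> t - \<psi> 0) \<le> M * (norm v)\<^sup>2" if "t \<in> {0..1}" for t
  proof -
    have "norm (\<psi> t - \<psi> 0) \<le> (M * (norm v)\<^sup>2) * norm (t - 0)"
    proof (rule differentiable_bound[of "{0..1}"])
      show "(\<psi> has_derivative (\<lambda>s. s *\<^sub>R blinfun_apply (blinfun_apply (f'' (x + t *\<^sub>R v)) v) v)) (at t within {0..1})" for t
        using psi by (simp add: has_vector_derivative_def)
      show "onorm (\<lambda>s::real. s *\<^sub>R blinfun_apply (blinfun_apply (f'' (x + t *\<^sub>R v)) v) v) \<le> M * (norm v)\<^sup>2" for t
        by (rule onorm_bound[OF M0])
          (use M[of "x + t *\<^sub>R v" v] in \<open>auto simp: mult.commute intro!: mult_left_mono\<close>)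
    qed (use that in auto)
    also have "\<dots> \<le> (M * (norm v)\<^sup>2) * 1"
      using that M0 by (intro mult_left_mono) auto
    finally show ?thesis by simp
  qed
  \<comment> \<open>With the initial slope removed, the derivative at t is
    \<open>\<psi> t - \<psi> 0\<close>.\<close>
  define \<phi> where "\<phi> t = f (x + t *\<^sub>R v) - t *\<^sub>R \<psi> 0" for t
  have "norm (\<phi> 1 - \<phi> 0) \<le> (M * (norm v)\<^sup>2) * norm (1 - 0 :: real)"
  proof (rule differentiable_bound[of "{0..1}"])
    show "(\<phi> has_derivative (\<lambda>s. s *\<^sub>R (\<psi> t - \<psi> 0))) (at t within {0..1})" for t
    proof -
      have "((\<lambda>t. f (x + t *\<^sub>R v)) has_derivative (\<lambda>s. blinfun_apply (f' (x + t *\<^sub>R v)) (s *\<^sub>R v))) (at t within {0..1})"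
        by (rule has_derivative_compose[OF _ f]) (auto intro!: derivative_eq_intros)
      then show ?thesis
        unfolding \<phi>_def
        by (auto intro!: derivative_eq_intros simp: \<psi>_def blinfun.scaleR_right scaleR_diff_right)
    qed
    show "onorm (\<lambda>s::real. s *\<^sub>R (\<psi> t - \<psi> 0)) \<le> M * (norm v)\<^sup>2" if "t \<in> {0..1}" for t
      by (rule onorm_bound[OF M0]) (use psi_le[OF that] in \<open>auto simp: mult.commute intro!: mult_left_mono\<close>)
  qed auto
  moreover have "\<phi> 1 - \<phi> 0 = f (x + v) - f x - blinfun_apply (f' x) v"
    by (simp add: \<phi>_def \<psi>_def)
  ultimately show ?thesis by simp
qed

text \<open>Replacing a deviation of \<open>b\<close> by \<open>J\<close> applied to that of
  \<open>a\<close> costs O(\<tau>^2), hence O(h \<tau>^3) in the averages. Up to such errors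
  everything is governed by \<open>W\<close>, half the size of the leading part -2 w / h of the
  gradient, where w is the adjoint of \<open>J\<close> applied to \<open>x\<close>.\<close>

lemma descent_vector_estimates:
  fixes a :: "nat \<Rightarrow> real ^ 'u" and b :: "nat \<Rightarrow> real ^ 'p" and Q :: "real ^ 'p ^ 'p"
  assumes K: "K \<ge> 1" and h: "h > 0" and M: "M \<ge> 1" and t: "0 \<le> \<tau>" and J: "linear J"
    and da: "\<And>i. i \<in> {1..K} \<Longrightarrow> norm (deviation K a i) \<le> \<tau>"
    and db: "\<And>i. i \<in> {1..K} \<Longrightarrow> norm (deviation K b i) \<le> M * \<tau>"
    and dba: "\<And>i. i \<in> {1..K} \<Longrightarrow> norm (deviation K b i - J (deviation K a i)) \<le> M * \<tau>\<^sup>2"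
    and MJ: "\<And>v. norm (J v) \<le> M * norm v"
    and MQ: "\<And>v. norm (Q *v v) \<le> M * norm v" and Q0: "\<And>v. 0 \<le> (Q *v v) \<bullet> v"
    and x: "norm x \<le> M * h" "x = h *\<^sub>R (Q *v r - Q *v (ens_cov K b b *v x))"
    and l: "\<And>w. l * \<tau>\<^sup>2 * (norm w)\<^sup>2 \<le> w \<bullet> (ens_cov K a a *v w)"
    and g: "\<And>v. g \<bullet> v = - 2 * ((Q *v r) \<bullet> J v)"
  defines "\<Delta> \<equiv> ens_cov K a b *v x" and "c \<equiv> 2 * M ^ 5" and "W \<equiv> norm (adjoint J x) / h"
  shows "norm \<Delta> \<le> h * \<tau>\<^sup>2 * W + c * h * \<tau> ^ 3"
    and "g \<bullet> \<Delta> \<le> - 2 * h * l * \<tau>\<^sup>2 * W\<^sup>2 + c * W * h * \<tau> ^ 3 + c * h * \<tau> ^ 3 * norm \<Delta>"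
    and "norm g \<le> 2 * W + c * (norm \<Delta> + h * \<tau> ^ 3)"
proof -
  define w where "w = adjoint J x"
  define S where "S = ens_cov K b b"
  have w: "w \<bullet> v = x \<bullet> J v" for v
    unfolding w_def using adjoint_works[OF J, of v x] by (simp add: inner_commute)
  have W: "norm w = h * W" and W0: "W \<ge> 0"
    using h by (simp_all add: W_def w_def)
  have M0: "M \<ge> 0" using M by simp
  \<comment> \<open>The fifth power is the largest that occurs below; lower ones are rounded up to
    it.\<close>
  have Mpow: "M ^ i \<le> M ^ 5" if "i \<le> 5" for i
    using M that by (rule power_increasing[rotated])
  \<comment> \<open>With exact linearization \<Delta> would be C w. Each summand of the error is a
    product of M \<tau>^2, M h and \<tau>.\<close>
  have e1: "norm (\<Delta> - ens_cov K a a *v w) \<le> M\<^sup>2 * h * \<tau> ^ 3"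
  proof -
    have eq: "\<Delta> - ens_cov K a a *v w =
        (1 / real K) *\<^sub>R (\<Sum>i=1..K. ((deviation K b i - J (deviation K a i)) \<bullet> x) *\<^sub>R deviation K a i)"
      by (simp add: \<Delta>_def ens_cov_mult_vec sum_subtractf inner_diff_left scaleR_diff_left
          scaleR_diff_right inner_commute[of _ w] inner_commute[of _ x] inner_diff_right w)
    have le: "norm (((deviation K b i - J (deviation K a i)) \<bullet> x) *\<^sub>R deviation K a i) \<le> M\<^sup>2 * h * \<tau> ^ 3"
      if i: "i \<in> {1..K}" for i
    proof -
      have "norm (((deviation K b i - J (deviation K a i)) \<bullet> x) *\<^sub>R deviation K a i)
          \<le> (norm (deviation K b i - J (deviation K a i)) * norm x) * norm (deviation K a i)"
        by (simp add: Cauchy_Schwarz_ineq2 mult_right_mono)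
      also have "\<dots> \<le> ((M * \<tau>\<^sup>2) * (M * h)) * \<tau>"
        using dba[OF i] da[OF i] x(1) M0 t h by (intro mult_mono) auto
      also have "\<dots> = M\<^sup>2 * h * \<tau> ^ 3"
        by (simp add: power2_eq_square power3_eq_cube)
      finally show ?thesis .
    qed
    show ?thesis
      unfolding eq by (rule norm_ens_average_le[OF K le])
  qed
  \<comment> \<open>The same exchange in the outer vector of C^pp x, which would turn it into J
    \<Delta>.\<close>
  have e2: "norm (S *v x - J \<Delta>) \<le> M ^ 3 * h * \<tau> ^ 3"
  proof -
    have eq: "S *v x - J \<Delta> =
        (1 / real K) *\<^sub>R (\<Sum>i=1..K. (deviation K b i \<bullet> x) *\<^sub>R (deviation K b i - J (deviation K a i)))"
      by (simp add: S_def \<Delta>_def ens_cov_mult_vec linear_scale[OF J] linear_sum[OF J] sum_subtractf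
          scaleR_diff_right)
    have le: "norm ((deviation K b i \<bullet> x) *\<^sub>R (deviation K b i - J (deviation K a i))) \<le> M ^ 3 * h * \<tau> ^ 3"
      if i: "i \<in> {1..K}" for i
    proof -
      have "norm ((deviation K b i \<bullet> x) *\<^sub>R (deviation K b i - J (deviation K a i)))
          \<le> (norm (deviation K b i) * norm x) * norm (deviation K b i - J (deviation K a i))"
        by (simp add: Cauchy_Schwarz_ineq2 mult_right_mono)
      also have "\<dots> \<le> ((M * \<tau>) * (M * h)) * (M * \<tau>\<^sup>2)"
        using dba[OF i] db[OF i] x(1) M0 t h by (intro mult_mono) auto
      also have "\<dots> = M ^ 3 * h * \<tau> ^ 3"
        by (simp add: power2_eq_square power3_eq_cube)
      finally show ?thesis .
    qed
    show ?thesis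
      unfolding eq by (rule norm_ens_average_le[OF K le])
  qed
  have ht: "0 \<le> h * \<tau> ^ 3"
    using h t by simp
  have c: "M\<^sup>2 * (h * \<tau> ^ 3) \<le> M ^ 5 * (h * \<tau> ^ 3)" "M ^ 3 * (h * \<tau> ^ 3) \<le> M ^ 5 * (h * \<tau> ^ 3)"
    using Mpow[of 2] Mpow[of 3] ht by (intro mult_right_mono; simp)+
  have c0: "0 \<le> M ^ 5 * (h * \<tau> ^ 3)"
    using M0 ht by simp
  have Cw: "norm (ens_cov K a a *v w) \<le> \<tau>\<^sup>2 * norm w"
    unfolding ens_cov_mult_vec
  proof (rule norm_ens_average_le[OF K])
    fix i assume i: "i \<in> {1..K}"
    have "norm ((deviation K a i \<bullet> w) *\<^sub>R deviation K a i) \<le> (norm (deviation K a i) * norm w) * norm (deviation K a i)"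
      by (simp add: Cauchy_Schwarz_ineq2 mult_right_mono)
    also have "\<dots> \<le> (\<tau> * norm w) * \<tau>"
      using da[OF i] t by (intro mult_mono) auto
    finally show "norm ((deviation K a i \<bullet> w) *\<^sub>R deviation K a i) \<le> \<tau>\<^sup>2 * norm w"
      by (simp add: power2_eq_square mult_ac)
  qed
  have "norm \<Delta> \<le> norm (ens_cov K a a *v w) + norm (\<Delta> - ens_cov K a a *v w)"
    by (metis norm_triangle_sub)
  also have "\<dots> \<le> \<tau>\<^sup>2 * norm w + M\<^sup>2 * h * \<tau> ^ 3"
    using Cw e1 by (rule add_mono)
  finally show "norm \<Delta> \<le> h * \<tau>\<^sup>2 * W + c * h * \<tau> ^ 3"
    using c c0 by (simp add: c_def W mult_ac)
  \<comment> \<open>Solving the equation for \<open>x\<close> for the residual expresses the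
    gradient through w and C^pp x.\<close>
  have Qr: "Q *v r = (1 / h) *\<^sub>R x + Q *v (S *v x)"
  proof -
    have "(1 / h) *\<^sub>R x = Q *v r - Q *v (S *v x)"
      using h by (subst x(2)) (simp add: S_def)
    then show ?thesis by simp
  qed
  have gv: "g \<bullet> v = - (2 / h) * (w \<bullet> v) - 2 * ((Q *v (S *v x)) \<bullet> J v)" for v
    unfolding g Qr by (simp add: inner_add_left w)
  have "l * \<tau>\<^sup>2 * (h * W)\<^sup>2 - (h * W) * (M\<^sup>2 * h * \<tau> ^ 3) \<le> w \<bullet> \<Delta>"
  proof -
    have "w \<bullet> \<Delta> = w \<bullet> (ens_cov K a a *v w) + w \<bullet> (\<Delta> - ens_cov K a a *v w)"
      by (simp add: inner_diff_right)
    moreover have "\<bar>w \<bullet> (\<Delta> - ens_cov K a a *v w)\<bar> \<le> (h * W) * (M\<^sup>2 * h * \<tau> ^ 3)"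
      using Cauchy_Schwarz_ineq2[of w "\<Delta> - ens_cov K a a *v w"] mult_left_mono[OF e1, of "norm w"]
      by (simp add: W[symmetric])
    ultimately show ?thesis
      using l[of w] unfolding W by linarith
  qed
  then have 1: "(2 / h) * (l * \<tau>\<^sup>2 * (h * W)\<^sup>2 - (h * W) * (M\<^sup>2 * h * \<tau> ^ 3)) \<le> (2 / h) * (w \<bullet> \<Delta>)"
    using h by (intro mult_left_mono) auto
  have 2: "(2 / h) * (l * \<tau>\<^sup>2 * (h * W)\<^sup>2 - (h * W) * (M\<^sup>2 * h * \<tau> ^ 3))
      = 2 * h * l * \<tau>\<^sup>2 * W\<^sup>2 - 2 * W * (M\<^sup>2 * (h * \<tau> ^ 3))"
    using h by (simp add: power2_eq_square algebra_simps)
  \<comment> \<open>The part (Q J \<Delta>) \<bullet> J \<Delta> is nonnegative and has the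
    favourable sign for descent; only the error \<open>e2\<close> remains.\<close>
  have 3: "- (M ^ 5 * (h * \<tau> ^ 3) * norm \<Delta>) \<le> (Q *v (S *v x)) \<bullet> J \<Delta>"
  proof -
    have "(Q *v (S *v x)) \<bullet> J \<Delta> = (Q *v J \<Delta>) \<bullet> J \<Delta> + (Q *v (S *v x - J \<Delta>)) \<bullet> J \<Delta>"
      by (simp add: matrix_vector_mult_diff_distrib inner_diff_left)
    moreover have "\<bar>(Q *v (S *v x - J \<Delta>)) \<bullet> J \<Delta>\<bar> \<le> (M * (M ^ 3 * h * \<tau> ^ 3)) * (M * norm \<Delta>)"
      by (rule order_trans[OF Cauchy_Schwarz_ineq2])
        (intro mult_mono MJ order_trans[OF MQ] mult_left_mono e2 order_refl M0 norm_ge_zero,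
          use M0 ht in \<open>simp add: mult.assoc\<close>)
    moreover have "(M * (M ^ 3 * h * \<tau> ^ 3)) * (M * norm \<Delta>) = M ^ 5 * (h * \<tau> ^ 3) * norm \<Delta>"
      by (simp add: eval_nat_numeral)
    ultimately show ?thesis
      using Q0[of "J \<Delta>"] by linarith
  qed
  have "2 * W * (M\<^sup>2 * (h * \<tau> ^ 3)) \<le> c * W * h * \<tau> ^ 3"
    using mult_left_mono[OF c(1), of "2 * W"] W0 by (simp add: c_def mult_ac)
  then show "g \<bullet> \<Delta> \<le> - 2 * h * l * \<tau>\<^sup>2 * W\<^sup>2 + c * W * h * \<tau> ^ 3 + c * h * \<tau> ^ 3 * norm \<Delta>"
    using 1 3 unfolding gv 2 by (simp add: c_def mult_ac)
  have Sx: "norm (S *v x) \<le> M * norm \<Delta> + M ^ 3 * (h * \<tau> ^ 3)"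
    using norm_triangle_sub[of "S *v x" "J \<Delta>"] MJ[of \<Delta>] e2 by (simp add: mult.assoc)
  \<comment> \<open>The gradient is tested with itself, so that one factor can be cancelled
    afterwards.\<close>
  have "norm g * norm g = g \<bullet> g"
    by (simp add: dot_square_norm power2_eq_square)
  also have "\<dots> \<le> (2 / h) * (norm w * norm g) + 2 * ((M * norm (S *v x)) * (M * norm g))"
  proof -
    have "\<bar>w \<bullet> g\<bar> \<le> norm w * norm g"
      by (rule Cauchy_Schwarz_ineq2)
    then have "- (2 / h) * (w \<bullet> g) \<le> (2 / h) * (norm w * norm g)"
      using h mult_left_mono[of "- (w \<bullet> g)" "norm w * norm g" "2 / h"] by simp
    moreover have "\<bar>(Q *v (S *v x)) \<bullet> J g\<bar> \<le> (M * norm (S *v x)) * (M * norm g)"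
      by (rule order_trans[OF Cauchy_Schwarz_ineq2]) (intro mult_mono MJ MQ, use M0 in auto)
    ultimately show ?thesis
      unfolding gv[of g] by linarith
  qed
  also have "\<dots> = (2 * W + 2 * M\<^sup>2 * norm (S *v x)) * norm g"
    using h by (simp add: W power2_eq_square algebra_simps)
  finally have "norm g \<le> 2 * W + 2 * M\<^sup>2 * norm (S *v x)"
    using W0 by (cases "g = 0") (auto simp: mult_le_cancel_right)
  also have "\<dots> \<le> 2 * W + 2 * M\<^sup>2 * (M * norm \<Delta> + M ^ 3 * (h * \<tau> ^ 3))"
    using Sx by (intro add_left_mono mult_left_mono) auto
  also have "\<dots> = 2 * W + 2 * (M ^ 3 * norm \<Delta> + M ^ 5 * (h * \<tau> ^ 3))"
    by (simp add: eval_nat_numeral algebra_simps)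
  also have "\<dots> \<le> 2 * W + 2 * (M ^ 5 * norm \<Delta> + M ^ 5 * (h * \<tau> ^ 3))"
    using Mpow[of 3] by (intro add_left_mono add_right_mono mult_left_mono mult_right_mono) auto
  finally show "norm g \<le> 2 * W + c * (norm \<Delta> + h * \<tau> ^ 3)"
    by (simp add: c_def algebra_simps)
qed

text \<open>With s = h \<tau>^2, the decrease 2 a s W^2 is spent in three portions: a s W^2 / 2
  absorbs c D^2, another a s W^2 / 2 absorbs the mixed terms by Young's inequality, and the
  remaining a s W^2 pays for \<kappa> s \<eta>^2.\<close>

lemma descent_real_estimate:
  fixes a c h \<tau> W D \<delta> \<eta> f f' :: real
  assumes a: "a > 0" and c: "c \<ge> 1" and h: "h > 0" and nonneg: "0 \<le> \<tau>" "0 \<le> W" "0 \<le> D" "0 \<le> \<eta>"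
    and D: "D \<le> h * \<tau>\<^sup>2 * W + c * h * \<tau> ^ 3"
    and \<delta>: "\<delta> \<le> - 2 * h * a * \<tau>\<^sup>2 * W\<^sup>2 + c * W * h * \<tau> ^ 3 + c * h * \<tau> ^ 3 * D"
    and \<eta>: "\<eta> \<le> 2 * W + c * (D + h * \<tau> ^ 3)"
    and f: "f' \<le> f + \<delta> + c * D\<^sup>2"
    and small: "h * \<tau>\<^sup>2 \<le> 1" "h * \<tau>\<^sup>2 \<le> a / (4 * c)"
  defines "\<kappa> \<equiv> a / (2 * (2 + c)\<^sup>2)"
  shows "\<kappa> * (h * \<tau>\<^sup>2) * \<eta>\<^sup>2
    \<le> f - f' + (c\<^sup>2 + 2 * c ^ 3 + 2 * c\<^sup>2 / a + 2 * \<kappa> * (c\<^sup>2 + c)\<^sup>2) * (h * \<tau>\<^sup>2) * \<tau>\<^sup>2"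
proof -
  define s where "s = h * \<tau>\<^sup>2"
  have s: "0 \<le> s" "s \<le> 1" "4 * c * s \<le> a"
    using h small c by (simp_all add: s_def field_simps)
  have hs: "h * \<tau> ^ 3 = s * \<tau>"
    by (simp add: s_def power2_eq_square power3_eq_cube)
  have D': "D \<le> s * (W + c * \<tau>)"
    using D hs by (simp add: s_def algebra_simps)
  also have "\<dots> \<le> 1 * (W + c * \<tau>)"
    using s nonneg c by (intro mult_right_mono) auto
  finally have D1: "D \<le> W + c * \<tau>" by simp
  have sq: "(x + y)\<^sup>2 \<le> 2 * x\<^sup>2 + 2 * y\<^sup>2" for x y :: real
    using zero_le_power2[of "x - y"] by (simp add: power2_eq_square algebra_simps)
  have "c * h * \<tau> ^ 3 * D = (c * s * \<tau>) * D"
    using hs by (simp add: mult.assoc)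
  also have "\<dots> \<le> (c * s * \<tau>) * (W + c * \<tau>)"
    using D1 s nonneg c by (intro mult_left_mono) auto
  finally have t1: "c * h * \<tau> ^ 3 * D \<le> s * (c * \<tau> * W + c\<^sup>2 * \<tau>\<^sup>2)"
    by (simp add: power2_eq_square algebra_simps)
  have t2: "c * D\<^sup>2 \<le> s * (a / 2 * W\<^sup>2 + 2 * c ^ 3 * \<tau>\<^sup>2)"
  proof -
    have "c * D\<^sup>2 \<le> c * (s * (W + c * \<tau>))\<^sup>2"
      using D' nonneg c by (intro mult_left_mono power_mono) auto
    also have "\<dots> = c * s\<^sup>2 * (W + c * \<tau>)\<^sup>2"
      by (simp add: power_mult_distrib)
    also have "\<dots> \<le> c * s\<^sup>2 * (2 * W\<^sup>2 + 2 * (c * \<tau>)\<^sup>2)"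
      using c by (intro mult_left_mono sq) auto
    also have "\<dots> = s * ((2 * c * s) * W\<^sup>2 + s * (2 * c ^ 3 * \<tau>\<^sup>2))"
      by (simp add: power2_eq_square power3_eq_cube algebra_simps)
    also have "\<dots> \<le> s * (a / 2 * W\<^sup>2 + 1 * (2 * c ^ 3 * \<tau>\<^sup>2))"
      using s c by (intro mult_left_mono add_mono mult_right_mono) auto
    finally show ?thesis by simp
  qed
  have t3: "2 * c * \<tau> * W \<le> a / 2 * W\<^sup>2 + 2 * c\<^sup>2 / a * \<tau>\<^sup>2"
  proof -
    have "0 \<le> (a * W - 2 * c * \<tau>)\<^sup>2 / (2 * a)"
      using a by simp
    also have "\<dots> = a / 2 * W\<^sup>2 + 2 * c\<^sup>2 / a * \<tau>\<^sup>2 - 2 * c * \<tau> * W"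
      using a by (simp add: power2_eq_square field_simps)
    finally show ?thesis by simp
  qed
  have "f' - f \<le> \<delta> + c * D\<^sup>2"
    using f by simp
  also have "\<dots> \<le> s * (- 2 * a * W\<^sup>2 + c * \<tau> * W) + s * (c * \<tau> * W + c\<^sup>2 * \<tau>\<^sup>2)
      + s * (a / 2 * W\<^sup>2 + 2 * c ^ 3 * \<tau>\<^sup>2)"
  proof -
    have "- 2 * h * a * \<tau>\<^sup>2 * W\<^sup>2 + c * W * h * \<tau> ^ 3 = s * (- 2 * a * W\<^sup>2) + c * W * (h * \<tau> ^ 3)"
      by (simp add: s_def)
    also have "\<dots> = s * (- 2 * a * W\<^sup>2 + c * \<tau> * W)"
      unfolding hs by (simp add: algebra_simps)
    finally show ?thesis
      using \<delta> t1 t2 by linarith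
  qed
  also have "\<dots> = s * (- (3 / 2) * a * W\<^sup>2 + 2 * c * \<tau> * W + (c\<^sup>2 + 2 * c ^ 3) * \<tau>\<^sup>2)"
    by (simp add: algebra_simps)
  also have "\<dots> \<le> s * (- (3 / 2) * a * W\<^sup>2 + (a / 2 * W\<^sup>2 + 2 * c\<^sup>2 / a * \<tau>\<^sup>2) + (c\<^sup>2 + 2 * c ^ 3) * \<tau>\<^sup>2)"
    using t3 s(1) by (intro mult_left_mono add_right_mono add_left_mono) auto
  also have "\<dots> = s * (- a * W\<^sup>2 + (c\<^sup>2 + 2 * c ^ 3 + 2 * c\<^sup>2 / a) * \<tau>\<^sup>2)"
    by (simp add: algebra_simps)
  finally have step: "f' - f \<le> s * (- a * W\<^sup>2 + (c\<^sup>2 + 2 * c ^ 3 + 2 * c\<^sup>2 / a) * \<tau>\<^sup>2)" .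
  \<comment> \<open>The right-hand side is (2 + c) W + (c^2 + c) \<tau>. The value of \<kappa> makes
    twice the square of the first term cost exactly a W^2.\<close>
  have "\<eta> \<le> 2 * W + c * ((W + c * \<tau>) + 1 * \<tau>)"
    unfolding hs using \<eta>[unfolded hs] D1 s nonneg c
    by (elim order_trans) (intro add_left_mono mult_left_mono add_mono mult_right_mono; simp)
  then have "\<eta>\<^sup>2 \<le> ((2 + c) * W + (c\<^sup>2 + c) * \<tau>)\<^sup>2"
    using nonneg by (intro power_mono) (auto simp: power2_eq_square algebra_simps)
  also have "\<dots> \<le> 2 * ((2 + c) * W)\<^sup>2 + 2 * ((c\<^sup>2 + c) * \<tau>)\<^sup>2"
    by (rule sq)
  finally have "\<kappa> * \<eta>\<^sup>2 \<le> \<kappa> * (2 * ((2 + c) * W)\<^sup>2 + 2 * ((c\<^sup>2 + c) * \<tau>)\<^sup>2)"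
    using a by (intro mult_left_mono) (auto simp: \<kappa>_def)
  also have "\<dots> = (\<kappa> * (2 * (2 + c)\<^sup>2)) * W\<^sup>2 + 2 * \<kappa> * (c\<^sup>2 + c)\<^sup>2 * \<tau>\<^sup>2"
    by (simp only: power_mult_distrib) (simp add: algebra_simps)
  also have "\<kappa> * (2 * (2 + c)\<^sup>2) = a"
    using c by (simp add: \<kappa>_def)
  finally have "s * (\<kappa> * \<eta>\<^sup>2) \<le> s * (a * W\<^sup>2 + 2 * \<kappa> * (c\<^sup>2 + c)\<^sup>2 * \<tau>\<^sup>2)"
    using s(1) by (rule mult_left_mono)
  with step show ?thesis
    by (simp add: s_def[symmetric] algebra_simps)
qed

section \<open>The gradient of the loss and one step of the iteration, with arbitrary step
  sizes\<close>

locale smooth_EKI =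
  fixes G :: "real ^ 'u \<Rightarrow> real ^ 'y"
    and y :: "real ^ 'y"
    and \<Gamma> :: "real ^ 'y ^ 'y"
    and \<Sigma> :: "real ^ 'u ^ 'u"
    and H' :: "real ^ 'u \<Rightarrow> (real ^ 'u) \<Rightarrow>\<^sub>L (real ^ ('y + 'u))"
    and H'' :: "real ^ 'u \<Rightarrow> (real ^ 'u) \<Rightarrow>\<^sub>L ((real ^ 'u) \<Rightarrow>\<^sub>L (real ^ ('y + 'u)))"
    and M\<^sub>1 M\<^sub>2 :: real
    and K :: nat
    and h \<alpha> :: "nat \<Rightarrow> real"
    and u :: "nat \<Rightarrow> nat \<Rightarrow> real ^ 'u"
  assumes pd_\<Gamma>: "sym_pos_def \<Gamma>" and pd_\<Sigma>: "sym_pos_def \<Sigma>"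
    and deriv: "\<And>x. (augmented G has_derivative blinfun_apply (H' x)) (at x)"
    and deriv2: "\<And>x. (H' has_derivative blinfun_apply (H'' x)) (at x)"
    and deriv_bound: "\<And>x. norm (H' x) \<le> M\<^sub>1"
    and lipschitz: "\<And>x x'. norm (augmented G x' - augmented G x) \<le> M\<^sub>1 * norm (x' - x)"
    and deriv2_bound: "\<And>x v. norm (blinfun_apply (blinfun_apply (H'' x) v) v) \<le> M\<^sub>2 * (norm v)\<^sup>2"
    and K: "K \<ge> 1"
    and EKI: "EKI_sequence G y \<Gamma> \<Sigma> K h \<alpha> u"
    and bounded_means: "bounded (range (\<lambda>n. ens_mean K (u n)))"
begin

abbreviation "B \<equiv> block_diag \<Gamma> \<Sigma>"
abbreviation "mean n \<equiv> ens_mean K (u n)"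
abbreviation "obs n \<equiv> (\<lambda>i. augmented G (u n i))"
abbreviation "cov n \<equiv> ens_cov K (u n) (u n)"
abbreviation "obs_cov n \<equiv> ens_cov K (obs n) (obs n)"
abbreviation "objective \<equiv> loss G y \<Gamma> \<Sigma>"

lemma pd_B: "sym_pos_def B"
  by (rule sym_pos_def_block_diag[OF pd_\<Gamma> pd_\<Sigma>])

lemma h_pos: "h n > 0" and \<alpha>_pos: "\<alpha> n > 0"
  using EKI by (simp_all add: EKI_sequence_def)

lemma M\<^sub>1_nonneg: "0 \<le> M\<^sub>1"
  using order_trans[OF norm_ge_zero deriv_bound] .

lemma M\<^sub>2_nonneg: "0 \<le> M\<^sub>2"
  using order_trans[OF norm_ge_zero deriv2_bound[of _ "axis undefined 1"]] by (simp add: norm_axis_1)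

lemma norm_deriv_le: "norm (H' x v) \<le> M\<^sub>1 * norm v"
  by (rule order_trans[OF norm_blinfun]) (simp add: deriv_bound mult_right_mono)

lemma objective_eq: "objective x = sqnorm_wrt B (augmented G x - stack y 0)"
  by (rule loss_eq_sqnorm_augmented[OF pd_\<Gamma> pd_\<Sigma>])

lemma objective_nonneg: "0 \<le> objective x"
  by (simp add: objective_eq sqnorm_wrt_nonneg pd_B)

text \<open>\<open>gradient\<close> is a definite description, so a gradient must be exhibited and
  shown to be unique. It is the adjoint derivative applied to the weighted residual; symmetry of the
  inverse merges the two product-rule terms.\<close>

lemma gradient_inner:
  "gradient objective x \<bullet> v = 2 * ((matrix_inv B *v (augmented G x - stack y 0)) \<bullet> H' x v)"
proof -
  define D where "D = adjoint (H' x) (2 *\<^sub>R (matrix_inv B *v (augmented G x - stack y 0)))"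
  have lin: "linear (H' x)"
    by (intro bounded_linear.linear blinfun.bounded_linear_right)
  have D: "v \<bullet> D = 2 * ((matrix_inv B *v (augmented G x - stack y 0)) \<bullet> H' x v)" for v
    using adjoint_works[OF lin, of v] by (simp add: D_def inner_commute)
  have "(objective has_derivative (\<lambda>v. (augmented G x - stack y 0) \<bullet> (matrix_inv B *v H' x v)
      + H' x v \<bullet> (matrix_inv B *v (augmented G x - stack y 0)))) (at x)"
    unfolding objective_eq[abs_def] sqnorm_wrt_def
    by (auto intro!: derivative_eq_intros deriv
        bounded_linear.has_derivative[OF matrix_vector_mul_bounded_linear])
  then have "GDERIV objective x :> D"
    unfolding gderiv_def D sym_pos_def_matrix_inv_symmetric[OF pd_B, of "augmented G x - stack y 0"]
    by (simp add: inner_commute)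
  moreover have "D' = D" if "GDERIV objective x :> D'" for D'
  proof -
    have "(\<lambda>v. v \<bullet> D') = (\<lambda>v. v \<bullet> D)"
      using that \<open>GDERIV objective x :> D\<close> unfolding gderiv_def by (rule has_derivative_unique)
    then show ?thesis
      by (metis vector_eq_ldot)
  qed
  ultimately have "gradient objective x = D"
    unfolding gradient_def by (rule the_equality)
  then show ?thesis
    using D[of v] by (simp add: inner_commute)
qed

lemma norm_deviation_obs_le:
  assumes "\<And>i. i \<in> {1..K} \<Longrightarrow> norm (deviation K (u n) i) \<le> \<tau>" and i: "i \<in> {1..K}"
  shows "norm (deviation K (obs n) i) \<le> 2 * (M\<^sub>1 * \<tau>)"
proof (rule norm_deviation_le[OF K i])
  fix j assume "j \<in> {1..K}"
  then have "M\<^sub>1 * norm (u n j - mean n) \<le> M\<^sub>1 * \<tau>"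
    using assms(1)[of j] M\<^sub>1_nonneg by (intro mult_left_mono) (auto simp: deviation_def)
  then show "norm (obs n j - augmented G (mean n)) \<le> M\<^sub>1 * \<tau>"
    using lipschitz order_trans by blast
qed

text \<open>Taylor's remainder at the mean puts every linearly corrected observation within
  \<open>M\<^sub>2 * \<tau>\<^sup>2\<close> of the augmented map at the mean; recentring doubles
  this.\<close>

lemma norm_deviation_obs_diff_linear_le:
  assumes "\<And>i. i \<in> {1..K} \<Longrightarrow> norm (deviation K (u n) i) \<le> \<tau>" and i: "i \<in> {1..K}"
  shows "norm (deviation K (obs n) i - H' (mean n) (deviation K (u n) i)) \<le> 2 * (M\<^sub>2 * \<tau>\<^sup>2)"
proof -
  have lin: "linear (H' (mean n))"
    by (intro bounded_linear.linear blinfun.bounded_linear_right)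
  show ?thesis
    unfolding deviation_diff_linear[OF K lin, symmetric]
  proof (rule norm_deviation_le[OF K i])
    fix j assume j: "j \<in> {1..K}"
    have "norm (obs n j - augmented G (mean n) - H' (mean n) (deviation K (u n) j))
        \<le> M\<^sub>2 * (norm (deviation K (u n) j))\<^sup>2"
      using norm_second_order_remainder_le[OF deriv deriv2 deriv2_bound, of "mean n" "deviation K (u n) j"]
      by (simp add: deviation_def)
    also have "\<dots> \<le> M\<^sub>2 * \<tau>\<^sup>2"
      using assms(1)[OF j] M\<^sub>2_nonneg by (intro mult_left_mono power_mono) auto
    finally show "norm (obs n j - H' (mean n) (deviation K (u n) j) - augmented G (mean n)) \<le> M\<^sub>2 * \<tau>\<^sup>2"
      by (simp add: algebra_simps)
  qed
qed

text \<open>The loss is exactly quadratic in the increment of the augmented map. The cross term is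
  the gradient term plus a Taylor remainder multiplied by the weighted residual, hence the bound
  assumed on the latter.\<close>

lemma objective_increment_le:
  assumes "norm (matrix_inv B *v (augmented G x - stack y 0)) \<le> M"
    and MB: "\<And>v. norm (matrix_inv B *v v) \<le> M * norm v"
  shows "objective (x + v) \<le> objective x + gradient objective x \<bullet> v + M * (2 * M\<^sub>2 + M\<^sub>1\<^sup>2) * (norm v)\<^sup>2"
proof -
  define q where "q = augmented G x - stack y 0"
  define e where "e = augmented G (x + v) - augmented G x"
  have e: "norm e \<le> M\<^sub>1 * norm v"
    using lipschitz[of "x + v" x] by (simp add: e_def)
  have M: "0 \<le> M"
    using order_trans[OF norm_ge_zero assms(1)] .
  have "objective (x + v) = (q + e) \<bullet> (matrix_inv B *v (q + e))"
    by (simp add: objective_eq sqnorm_wrt_def q_def e_def)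
  also have "\<dots> = objective x + 2 * ((matrix_inv B *v q) \<bullet> e) + (matrix_inv B *v e) \<bullet> e"
    using sym_pos_def_matrix_inv_symmetric[OF pd_B, of q e] inner_commute[of e "matrix_inv B *v q"]
      inner_commute[of e "matrix_inv B *v e"]
    by (simp add: objective_eq sqnorm_wrt_def matrix_vector_right_distrib inner_add_left inner_add_right
        flip: q_def)
  also have "\<dots> = objective x + gradient objective x \<bullet> v + 2 * ((matrix_inv B *v q) \<bullet> (e - H' x v))
      + (matrix_inv B *v e) \<bullet> e"
    by (simp add: gradient_inner inner_diff_right flip: q_def)
  also have "\<dots> \<le> objective x + gradient objective x \<bullet> v + 2 * (M * (M\<^sub>2 * (norm v)\<^sup>2))
      + (M * (M\<^sub>1 * norm v)) * (M\<^sub>1 * norm v)"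
  proof (intro add_mono order_refl mult_left_mono)
    have "norm (e - H' x v) \<le> M\<^sub>2 * (norm v)\<^sup>2"
      unfolding e_def by (rule norm_second_order_remainder_le[OF deriv deriv2 deriv2_bound])
    then have "norm (matrix_inv B *v q) * norm (e - H' x v) \<le> M * (M\<^sub>2 * (norm v)\<^sup>2)"
      using assms(1) M unfolding q_def by (intro mult_mono) auto
    then show "(matrix_inv B *v q) \<bullet> (e - H' x v) \<le> M * (M\<^sub>2 * (norm v)\<^sup>2)"
      using norm_cauchy_schwarz order_trans by blast
    have "norm (matrix_inv B *v e) * norm e \<le> (M * (M\<^sub>1 * norm v)) * (M\<^sub>1 * norm v)"
      using e M M\<^sub>1_nonneg by (intro mult_mono order_trans[OF MB] mult_left_mono) auto
    then show "(matrix_inv B *v e) \<bullet> e \<le> (M * (M\<^sub>1 * norm v)) * (M\<^sub>1 * norm v)"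
      using norm_cauchy_schwarz order_trans by blast
  qed simp
  finally show ?thesis
    by (simp add: power2_eq_square algebra_simps)
qed

text \<open>The Lipschitz bound transfers boundedness from the means to the residuals, which makes
  the constants of the descent inequality uniform in n.\<close>

lemma residual_bounded:
  obtains R where "R > 0" and "\<And>n. norm (augmented G (mean n) - stack y 0) \<le> R"
proof -
  obtain b where b: "\<And>n. norm (mean n) \<le> b"
    using bounded_means unfolding bounded_iff by auto
  have "norm (augmented G (mean n) - stack y 0) \<le> M\<^sub>1 * b + norm (augmented G 0 - stack y 0)" for n
  proof -
    have "norm (augmented G (mean n) - augmented G 0) \<le> M\<^sub>1 * b"
      using lipschitz[of "mean n" 0] mult_left_mono[OF b[of n] M\<^sub>1_nonneg] by simp
    moreover have "augmented G (mean n) - stack y 0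
        = (augmented G (mean n) - augmented G 0) + (augmented G 0 - stack y 0)"
      by simp
    ultimately show ?thesis
      using norm_triangle_le[of "augmented G (mean n) - augmented G 0" "augmented G 0 - stack y 0"] by simp
  qed
  then show thesis
    using that[of "max 1 (M\<^sub>1 * b + norm (augmented G 0 - stack y 0))"] by (simp add: le_max_iff_disj)
qed

text \<open>The vector x of the overview: C^up maps it to the shift of the mean.\<close>

definition weight :: "nat \<Rightarrow> real ^ ('y + 'u)" where
  "weight n = matrix_inv (innovation_cov G B K (h n) (u n)) *v (stack y 0 - augmented G (mean n))"

lemma weight_eq: "obs_cov n *v weight n + (1 / h n) *\<^sub>R (B *v weight n) = stack y 0 - augmented G (mean n)"
  using matrix_inv_mult_vec[OF sym_pos_def_invertible[OF sym_pos_def_innovation_cov[OF pd_B h_pos]],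
      of G K n "u n" "stack y 0 - augmented G (mean n)"]
  by (simp add: weight_def innovation_cov_def matrix_vector_mult_add_rdistrib
      flip: scaleR_matrix_vector_assoc)

text \<open>Applying h times the inverse of \<open>B\<close> to \<open>weight_eq\<close> removes the
  inverse of the innovation covariance.\<close>

lemma weight_fixpoint:
  "weight n = h n *\<^sub>R (matrix_inv B *v (stack y 0 - augmented G (mean n))
    - matrix_inv B *v (obs_cov n *v weight n))"
proof -
  have "matrix_inv B *v (B *v weight n) = weight n"
    by (rule matrix_inv_mult_vec_unique[OF sym_pos_def_invertible[OF pd_B] refl])
  then show ?thesis
    using h_pos[of n]
    by (simp add: weight_eq[symmetric] matrix_vector_right_distrib matrix_vector_mult_scaleR)
qed

lemma norm_weight_le:
  assumes \<sigma>: "\<sigma> > 0" "\<And>v. \<sigma> * (norm v)\<^sup>2 \<le> v \<bullet> (B *v v)"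
  shows "norm (weight n) \<le> norm (augmented G (mean n) - stack y 0) / \<sigma> * h n"
proof -
  let ?x = "weight n" and ?r = "stack y 0 - augmented G (mean n)"
  have "(\<sigma> * (norm ?x)\<^sup>2) / h n \<le> (?x \<bullet> (B *v ?x)) / h n"
    using \<sigma>(2)[of ?x] h_pos[of n] by (intro divide_right_mono) auto
  also have "\<dots> \<le> ?x \<bullet> ?r"
    using ens_cov_nonneg[of ?x K "obs n"] by (simp add: inner_add_right flip: weight_eq)
  also have "\<dots> \<le> norm ?x * norm ?r"
    by (rule norm_cauchy_schwarz)
  finally have "(\<sigma> * norm ?x / h n) * norm ?x \<le> norm ?r * norm ?x"
    by (simp add: power2_eq_square mult_ac)
  then have "\<sigma> * norm ?x / h n \<le> norm ?r \<or> ?x = 0"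
    by (metis mult_right_le_imp_le zero_less_norm_iff)
  then show ?thesis
    using \<sigma>(1) h_pos[of n] by (auto simp: field_simps norm_minus_commute)
qed

text \<open>The constant \<open>c\<close> is fixed before n, a and \<tau>, so that the covariance
  rates can be inserted afterwards.\<close>

lemma objective_descent:
  obtains c where "c \<ge> 1" and
    "\<And>n a \<tau>. \<lbrakk>a > 0; 0 \<le> \<tau>; \<And>i. i \<in> {1..K} \<Longrightarrow> norm (deviation K (u n) i) \<le> \<tau>;
        \<And>w. a * \<tau>\<^sup>2 * (norm w)\<^sup>2 \<le> w \<bullet> (cov n *v w); h n * \<tau>\<^sup>2 \<le> 1; h n * \<tau>\<^sup>2 \<le> a / (4 * c)\<rbrakk> \<Longrightarrow>
      a / (2 * (2 + c)\<^sup>2) * (h n * \<tau>\<^sup>2) * (norm (gradient objective (mean n)))\<^sup>2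
      \<le> objective (mean n) - objective (mean (Suc n))
        + (c\<^sup>2 + 2 * c ^ 3 + 2 * c\<^sup>2 / a + 2 * (a / (2 * (2 + c)\<^sup>2)) * (c\<^sup>2 + c)\<^sup>2) * (h n * \<tau>\<^sup>2) * \<tau>\<^sup>2"
proof -
  obtain R where R: "R > 0" "\<And>n. norm (augmented G (mean n) - stack y 0) \<le> R"
    using residual_bounded by blast
  obtain \<sigma> where \<sigma>: "\<sigma> > 0" "\<And>v. \<sigma> * (norm v)\<^sup>2 \<le> v \<bullet> (B *v v)"
    using sym_pos_def_coercive[OF pd_B] by blast
  obtain b where b: "b > 0" "\<And>v. norm (matrix_inv B *v v) \<le> b * norm v"
    using matrix_mult_vec_bounded by blast
  \<comment> \<open>One constant dominating all others: R / \<sigma> bounds the weight relative to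
    h, b R bounds the weighted residual, and the doubled derivative bounds account for the
    recentring of deviations.\<close>
  define M where "M = 1 + 2 * M\<^sub>1 + 2 * M\<^sub>2 + b + b * R + R / \<sigma>"
  have bR: "0 \<le> b * R" "0 \<le> R / \<sigma>"
    using b R \<sigma> by simp_all
  have M: "1 \<le> M" "2 * M\<^sub>1 \<le> M" "2 * M\<^sub>2 \<le> M" "b \<le> M" "b * R \<le> M" "R / \<sigma> \<le> M"
    unfolding M_def using M\<^sub>1_nonneg M\<^sub>2_nonneg b(1) bR by linarith+
  define c where "c = 2 * M ^ 5"
  have c: "c \<ge> 1"
    using one_le_power[OF M(1), of 5] unfolding c_def by linarith
  have MB: "norm (matrix_inv B *v v) \<le> M * norm v" for v
    using b(2)[of v] mult_right_mono[OF M(4), of "norm v"] by simp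
  have Mq: "norm (matrix_inv B *v (augmented G (mean n) - stack y 0)) \<le> M" for n
    using b(2)[of "augmented G (mean n) - stack y 0"] mult_left_mono[OF R(2)[of n], of b] b(1) M(5)
    by linarith
  have "M * (2 * M\<^sub>2 + M\<^sub>1\<^sup>2) \<le> M * (M + M\<^sup>2)"
    using M M\<^sub>1_nonneg by (intro mult_left_mono add_mono power_mono) auto
  also have "\<dots> = M ^ 2 + M ^ 3"
    by (simp add: eval_nat_numeral algebra_simps)
  also have "\<dots> \<le> M ^ 5 + M ^ 5"
    using M(1) by (intro add_mono power_increasing) auto
  finally have cM: "M * (2 * M\<^sub>2 + M\<^sub>1\<^sup>2) \<le> c"
    by (simp add: c_def)
  show thesis
  proof (rule that[OF c])
    fix n a \<tau>
    assume a: "a > 0" and \<tau>: "0 \<le> \<tau>" and dev: "\<And>i. i \<in> {1..K} \<Longrightarrow> norm (deviation K (u n) i) \<le> \<tau>"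
      and low: "\<And>w. a * \<tau>\<^sup>2 * (norm w)\<^sup>2 \<le> w \<bullet> (cov n *v w)"
      and small: "h n * \<tau>\<^sup>2 \<le> 1" "h n * \<tau>\<^sup>2 \<le> a / (4 * c)"
    let ?g = "gradient objective (mean n)"
    let ?\<Delta> = "ens_cov K (u n) (obs n) *v weight n"
    let ?W = "norm (adjoint (blinfun_apply (H' (mean n))) (weight n)) / h n"
    have lin: "linear (H' (mean n))"
      by (intro bounded_linear.linear blinfun.bounded_linear_right)
    have db: "norm (deviation K (obs n) i) \<le> M * \<tau>" if "i \<in> {1..K}" for i
      using norm_deviation_obs_le[OF dev that] mult_right_mono[OF M(2) \<tau>] by simp
    have dba: "norm (deviation K (obs n) i - H' (mean n) (deviation K (u n) i)) \<le> M * \<tau>\<^sup>2"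
      if "i \<in> {1..K}" for i
      using norm_deviation_obs_diff_linear_le[OF dev that] mult_right_mono[OF M(3), of "\<tau>\<^sup>2"] by simp
    have MJ: "norm (H' (mean n) v) \<le> M * norm v" for v
      using norm_deriv_le[of "mean n" v] M\<^sub>1_nonneg M(2) mult_right_mono[of M\<^sub>1 M "norm v"] by simp
    have Q0: "0 \<le> (matrix_inv B *v v) \<bullet> v" for v
      using sqnorm_wrt_nonneg[OF pd_B, of v] by (simp add: sqnorm_wrt_def inner_commute)
    have "norm (augmented G (mean n) - stack y 0) / \<sigma> \<le> M"
      using divide_right_mono[OF R(2)[of n], of \<sigma>] \<sigma>(1) M(6) by simp
    then have x: "norm (weight n) \<le> M * h n"
      using norm_weight_le[OF \<sigma>, of n] h_pos[of n] by (meson less_imp_le mult_right_mono order_trans)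
    have g: "?g \<bullet> v = - 2 * ((matrix_inv B *v (stack y 0 - augmented G (mean n))) \<bullet> H' (mean n) v)" for v
      by (simp add: gradient_inner matrix_vector_mult_diff_distrib inner_diff_left)
    note est = descent_vector_estimates[where J = "blinfun_apply (H' (mean n))" and Q = "matrix_inv B"
        and a = "u n" and b = "obs n" and h = "h n" and x = "weight n" and g = "?g",
        OF K h_pos M(1) \<tau> lin dev db dba MJ MB Q0 x weight_fixpoint low g, folded c_def]
    have "mean (Suc n) = mean n + ?\<Delta>"
      unfolding weight_def by (rule EKI_mean_update[OF EKI])
    then have "objective (mean (Suc n))
        \<le> objective (mean n) + ?g \<bullet> ?\<Delta> + M * (2 * M\<^sub>2 + M\<^sub>1\<^sup>2) * (norm ?\<Delta>)\<^sup>2"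
      using objective_increment_le[OF Mq MB, of n ?\<Delta>] by simp
    also have "\<dots> \<le> objective (mean n) + ?g \<bullet> ?\<Delta> + c * (norm ?\<Delta>)\<^sup>2"
      using cM by (intro add_left_mono mult_right_mono) auto
    finally have f: "objective (mean (Suc n)) \<le> objective (mean n) + ?g \<bullet> ?\<Delta> + c * (norm ?\<Delta>)\<^sup>2" .
    show "a / (2 * (2 + c)\<^sup>2) * (h n * \<tau>\<^sup>2) * (norm ?g)\<^sup>2
      \<le> objective (mean n) - objective (mean (Suc n))
        + (c\<^sup>2 + 2 * c ^ 3 + 2 * c\<^sup>2 / a + 2 * (a / (2 * (2 + c)\<^sup>2)) * (c\<^sup>2 + c)\<^sup>2) * (h n * \<tau>\<^sup>2) * \<tau>\<^sup>2"
      by (rule descent_real_estimate[where W = ?W and D = "norm ?\<Delta>" and h = "h n" and \<eta> = "norm ?g"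
          and \<delta> = "?g \<bullet> ?\<Delta>", OF a c h_pos \<tau> _ norm_ge_zero norm_ge_zero est f small])
        (use h_pos[of n] in simp)
  qed
qed

end

section \<open>From descent to iteration complexity\<close>

text \<open>The summands decrease, so each is at least the last one.\<close>

lemma powr_sum_ge:
  assumes "\<gamma> < 1"
  shows "real N powr \<gamma> \<le> (\<Sum>n=1..N. real n powr (\<gamma> - 1))"
proof (cases "N = 0")
  case False
  have "real N * real N powr (\<gamma> - 1) \<le> (\<Sum>n=1..N. real n powr (\<gamma> - 1))"
    using sum_bounded_below[of "{1..N}" "real N powr (\<gamma> - 1)" "\<lambda>n. real n powr (\<gamma> - 1)"] assms
    by (simp add: powr_mono2')
  moreover have "real N * real N powr (\<gamma> - 1) = real N powr \<gamma>"
    using False powr_add[of "real N" 1 "\<gamma> - 1"] by simp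
  ultimately show ?thesis by simp
qed simp

text \<open>Serves the case \<gamma> = 0, where \<open>powr_sum_ge\<close> yields only the bound
  1.\<close>

lemma ln_Suc_le_harmonic: "ln (real (Suc N)) \<le> (\<Sum>n=1..N. 1 / real n)"
proof (induction N)
  case (Suc N)
  have "real (Suc (Suc N)) = real (Suc N) * (1 + 1 / real (Suc N))"
    by (simp add: field_simps)
  then have "ln (real (Suc (Suc N))) = ln (real (Suc N)) + ln (1 + 1 / real (Suc N))"
    by (metis add_pos_nonneg divide_nonneg_nonneg ln_mult_pos of_nat_0_le_iff of_nat_0_less_iff
        zero_le_one zero_less_Suc zero_less_one)
  also have "\<dots> \<le> (\<Sum>n=1..N. 1 / real n) + 1 / real (Suc N)"
    using Suc ln_add_one_self_le_self[of "1 / real (Suc N)"] by (intro add_mono) auto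
  finally show ?case by simp
qed simp

lemma powr_partial_sums_bounded:
  assumes "d > 0"
  obtains Z where "Z > 0" and "\<And>N. (\<Sum>n=1..N. real n powr (- 1 - d)) \<le> Z"
proof -
  have "summable (\<lambda>n. real n powr (- 1 - d))"
    using assms by (simp add: summable_real_powr_iff)
  then have "(\<Sum>n=1..N. real n powr (- 1 - d)) \<le> (\<Sum>n. real n powr (- 1 - d))" for N
    by (intro sum_le_suminf) auto
  then show thesis
    using that[of "max 1 (\<Sum>n. real n powr (- 1 - d))"] by (simp add: le_max_iff_disj)
qed

text \<open>Telescoping the descent inequality; the finitely many steps before it sets in go into \<open>F\<close>.\<close>

lemma descent_weighted_sum:
  fixes f l w e :: "nat \<Rightarrow> real"
  assumes w: "\<And>n. 0 \<le> w n" and e: "\<And>n. 0 \<le> e n" and l: "\<And>n. 0 \<le> l n" and f: "\<And>n. 0 \<le> f n"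
    and descent: "\<And>n. n \<ge> n\<^sub>0 \<Longrightarrow> w n * f n \<le> l n - l (Suc n) + e n"
  obtains F where "F > 0" and "\<And>N. (\<Sum>n=1..N. w n * f n) \<le> F + (\<Sum>n=1..N. e n)"
proof -
  define F where "F = (\<Sum>n<Suc n\<^sub>0. w n * f n) + l (Suc n\<^sub>0) + 1"
  have *: "(\<Sum>n=1..N. w n * f n) + l (Suc N) \<le> F + (\<Sum>n=1..N. e n)" if "N \<ge> n\<^sub>0" for N
    using that
  proof (induction N rule: dec_induct)
    case base
    have "(\<Sum>n=1..n\<^sub>0. w n * f n) \<le> (\<Sum>n<Suc n\<^sub>0. w n * f n)"
      using w f by (intro sum_mono2) auto
    moreover have "0 \<le> (\<Sum>n=1..n\<^sub>0. e n)"
      using e by (simp add: sum_nonneg)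
    ultimately show ?case by (simp add: F_def)
  next
    case (step N)
    then show ?case
      using descent[of "Suc N"] by simp
  qed
  have "(\<Sum>n=1..N. w n * f n) \<le> F + (\<Sum>n=1..N. e n)" for N
  proof (cases "N \<ge> n\<^sub>0")
    case True
    then show ?thesis
      using *[OF True] l[of "Suc N"] by linarith
  next
    case False
    then have "(\<Sum>n=1..N. w n * f n) \<le> (\<Sum>n<Suc n\<^sub>0. w n * f n)"
      using w f by (intro sum_mono2) auto
    moreover have "0 \<le> (\<Sum>n=1..N. e n)"
      using e by (simp add: sum_nonneg)
    ultimately show ?thesis
      using l[of "Suc n\<^sub>0"] by (simp add: F_def)
  qed
  moreover have "F > 0"
    using w f l[of "Suc n\<^sub>0"] sum_nonneg[of "{..<Suc n\<^sub>0}" "\<lambda>n. w n * f n"] by (simp add: F_def)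
  ultimately show thesis using that by blast
qed

text \<open>The exponent is at most \<gamma> - e plus the summable exponent -1 - d. This splitting
  avoids distinguishing convergent, logarithmic and polynomially growing error sums.\<close>

lemma powr_error_sum_le:
  assumes "0 \<le> \<gamma> - e" and "e \<le> d"
  shows "(\<Sum>n=1..N. real n powr (\<gamma> - 1 - 2 * d)) \<le> real N powr (\<gamma> - e) * (\<Sum>n=1..N. real n powr (- 1 - d))"
  unfolding sum_distrib_left
proof (rule sum_mono)
  fix n assume n: "n \<in> {1..N}"
  have "real n powr (\<gamma> - 1 - 2 * d) \<le> real n powr ((\<gamma> - e) + (- 1 - d))"
    using n assms by (intro powr_mono) auto
  also have "\<dots> = real n powr (\<gamma> - e) * real n powr (- 1 - d)"
    by (rule powr_add)
  also have "\<dots> \<le> real N powr (\<gamma> - e) * real n powr (- 1 - d)"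
    using n assms by (intro mult_right_mono powr_mono2) auto
  finally show "real n powr (\<gamma> - 1 - 2 * d) \<le> real N powr (\<gamma> - e) * real n powr (- 1 - d)" .
qed

text \<open>If f exceeds \<epsilon> up to N, the summed descent gives \<epsilon>^2 N^\<gamma> \<le>
  \<open>D\<^sub>0\<close> N^(\<gamma>-e), that is, \<epsilon>^2 N^e \<le> \<open>D\<^sub>0\<close>.
  For \<gamma> = 0 a logarithm replaces N^\<gamma> and the right-hand side is constant.\<close>

lemma iteration_complexity:
  fixes f l :: "nat \<Rightarrow> real"
  assumes \<kappa>: "\<kappa> > 0" and E: "E \<ge> 0" and l: "\<And>n. 0 \<le> l n" and f: "\<And>n. 0 \<le> f n"
    and \<gamma>: "0 \<le> \<gamma>" "\<gamma> < 1" and \<beta>: "\<gamma> - 1 < \<beta>"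
    and descent: "\<And>n. n \<ge> n\<^sub>0 \<Longrightarrow> \<kappa> * real n powr (\<gamma> - 1) * (f n)\<^sup>2
      \<le> l n - l (Suc n) + E * real n powr (2 * \<gamma> - \<beta> - 2)"
  obtains D where "D > 0" and
    "\<And>\<epsilon>. \<epsilon> > 0 \<Longrightarrow> \<exists>n. real n \<le> threshold_iteration \<beta> \<gamma> D \<epsilon> \<and> f n \<le> \<epsilon>"
proof -
  \<comment> \<open>The error exponent becomes \<gamma> - 1 - 2 d. The strict lower bound on \<beta>
    makes d positive, which gives the summability behind \<open>Z\<close>.\<close>
  define d where "d = (\<beta> + 1 - \<gamma>) / 2"
  have d: "d > 0" and \<beta>d: "2 * \<gamma> - \<beta> - 2 = \<gamma> - 1 - 2 * d"
    using \<beta> by (simp_all add: d_def field_simps)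
  obtain Z where Z: "Z > 0" "\<And>N. (\<Sum>n=1..N. real n powr (- 1 - d)) \<le> Z"
    using powr_partial_sums_bounded[OF d] by blast
  obtain F where F: "F > 0" "\<And>N. (\<Sum>n=1..N. \<kappa> * real n powr (\<gamma> - 1) * (f n)\<^sup>2)
      \<le> F + (\<Sum>n=1..N. E * real n powr (2 * \<gamma> - \<beta> - 2))"
    using descent_weighted_sum[of "\<lambda>n. \<kappa> * real n powr (\<gamma> - 1)" "\<lambda>n. E * real n powr (2 * \<gamma> - \<beta> - 2)"
        l "\<lambda>n. (f n)\<^sup>2" n\<^sub>0] \<kappa> E l descent by auto
  define D\<^sub>0 where "D\<^sub>0 = (F + E * Z) / \<kappa>"
  have D\<^sub>0: "D\<^sub>0 > 0"
    using \<kappa> E Z(1) F(1) by (simp add: D\<^sub>0_def add_pos_nonneg)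
  \<comment> \<open>Stated for general e to serve both regimes: e = 0 if \<gamma> = 0, and e = min
    \<gamma> d otherwise. The condition e \<le> \<gamma> makes the power of N at least 1, so it
    absorbs the constant F.\<close>
  have sum_le: "\<epsilon>\<^sup>2 * (\<Sum>n=1..N. real n powr (\<gamma> - 1)) \<le> D\<^sub>0 * real N powr (\<gamma> - e)"
    if \<epsilon>: "\<epsilon> > 0" and big: "\<And>n. n \<le> N \<Longrightarrow> f n > \<epsilon>" and e: "0 \<le> \<gamma> - e" "e \<le> d" and N: "N \<ge> 1" for \<epsilon> e N
  proof -
    have N1: "1 \<le> real N powr (\<gamma> - e)"
      using N e by (simp add: ge_one_powr_ge_zero)
    have "\<kappa> * (\<epsilon>\<^sup>2 * (\<Sum>n=1..N. real n powr (\<gamma> - 1))) \<le> (\<Sum>n=1..N. \<kappa> * real n powr (\<gamma> - 1) * (f n)\<^sup>2)"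
      unfolding sum_distrib_left
    proof (rule sum_mono)
      fix n assume "n \<in> {1..N}"
      then have "\<epsilon>\<^sup>2 \<le> (f n)\<^sup>2"
        using \<epsilon> big[of n] by (intro power_mono) auto
      then have "(\<kappa> * real n powr (\<gamma> - 1)) * \<epsilon>\<^sup>2 \<le> (\<kappa> * real n powr (\<gamma> - 1)) * (f n)\<^sup>2"
        using \<kappa> by (intro mult_left_mono) auto
      then show "\<kappa> * (\<epsilon>\<^sup>2 * real n powr (\<gamma> - 1)) \<le> \<kappa> * real n powr (\<gamma> - 1) * (f n)\<^sup>2"
        by (simp add: mult_ac)
    qed
    also have "\<dots> \<le> F + E * (\<Sum>n=1..N. real n powr (\<gamma> - 1 - 2 * d))"
      using F(2)[of N] by (simp add: \<beta>d sum_distrib_left)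
    also have "\<dots> \<le> F * real N powr (\<gamma> - e) + E * (real N powr (\<gamma> - e) * Z)"
    proof (intro add_mono mult_left_mono E)
      show "F \<le> F * real N powr (\<gamma> - e)"
        using F(1) N1 by simp
      show "(\<Sum>n=1..N. real n powr (\<gamma> - 1 - 2 * d)) \<le> real N powr (\<gamma> - e) * Z"
        using powr_error_sum_le[OF e, of N] mult_left_mono[OF Z(2)[of N], of "real N powr (\<gamma> - e)"] by simp
    qed
    also have "\<dots> = \<kappa> * (D\<^sub>0 * real N powr (\<gamma> - e))"
    proof -
      have "F + E * Z = \<kappa> * D\<^sub>0"
        using \<kappa> by (simp add: D\<^sub>0_def)
      then show ?thesis
        by (metis distrib_right mult.assoc mult.commute)
    qed
    finally show ?thesis
      using \<kappa> by simp
  qed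
  \<comment> \<open>The summand (f 0)^2 covers all \<epsilon> \<ge> f 0 and otherwise forces D /
    \<epsilon>^2 > 1, so that N \<ge> 1. The factor 2 pays for rounding the threshold down and, when
    \<gamma> = 0, makes the contradiction strict.\<close>
  define D where "D = 2 * D\<^sub>0 + (f 0)\<^sup>2"
  have D: "D > 0" "2 * D\<^sub>0 \<le> D" "(f 0)\<^sup>2 \<le> D"
    using D\<^sub>0 by (auto simp: D_def add_pos_nonneg)
  have "\<exists>n. real n \<le> threshold_iteration \<beta> \<gamma> D \<epsilon> \<and> f n \<le> \<epsilon>" if \<epsilon>: "\<epsilon> > 0" for \<epsilon>
  proof (rule ccontr)
    define T where "T = threshold_iteration \<beta> \<gamma> D \<epsilon>"
    define N where "N = nat \<lfloor>T\<rfloor>"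
    have T0: "T \<ge> 0"
      by (simp add: T_def threshold_iteration_def)
    have NT: "real N \<le> T" "T < real N + 1"
      using T0 unfolding N_def by linarith+
    assume neg: "\<not> ?thesis"
    then have big: "f n > \<epsilon>" if "n \<le> N" for n
      using NT(1) that unfolding T_def[symmetric] by (meson not_le of_nat_le_iff order_trans)
    have "\<epsilon>\<^sup>2 < (f 0)\<^sup>2"
      using \<epsilon> big[of 0] by (intro power_strict_mono) auto
    then have D\<epsilon>: "D / \<epsilon>\<^sup>2 > 1"
      using D(3) \<epsilon> by simp
    show False
    proof (cases "\<gamma> = 0")
      case True
      then have T: "T = exp (D / \<epsilon>\<^sup>2)"
        by (simp add: T_def threshold_iteration_def)
      have N: "N \<ge> 1"
        using NT(2) T D\<epsilon> one_le_exp_iff[of "D / \<epsilon>\<^sup>2"] by (cases N) auto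
      have "D / \<epsilon>\<^sup>2 \<le> ln (real (Suc N))"
        using NT(2) unfolding T by (subst ln_ge_iff) auto
      also have "\<dots> \<le> (\<Sum>n=1..N. real n powr (\<gamma> - 1))"
        using ln_Suc_le_harmonic[of N] True by (simp add: powr_minus_divide)
      finally have "D \<le> \<epsilon>\<^sup>2 * (\<Sum>n=1..N. real n powr (\<gamma> - 1))"
        using \<epsilon> by (simp add: field_simps)
      also have "\<dots> \<le> D\<^sub>0 * real N powr (\<gamma> - 0)"
        using \<epsilon> big \<gamma>(1) d N by (intro sum_le) auto
      finally show False
        using True N D D\<^sub>0 by simp
    next
      case False
      define e where "e = min \<gamma> d"
      have e: "0 < e" "0 \<le> \<gamma> - e" "e \<le> d" "e < 1"
        using False \<gamma> d by (auto simp: e_def)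
      have "min (2 * \<gamma>) (\<beta> + 1 - \<gamma>) = 2 * e"
        unfolding e_def d_def by (auto simp: min_def)
      then have T: "T = (D / \<epsilon>\<^sup>2) powr (1 / e)"
        using False by (simp add: T_def threshold_iteration_def)
      have "T \<ge> 1"
        unfolding T using D\<epsilon> e(1) by (intro ge_one_powr_ge_zero) auto
      then have N: "N \<ge> 1"
        using NT(2) by (cases N) auto
      have "D / \<epsilon>\<^sup>2 = T powr e"
        unfolding T using e(1) D\<epsilon> D(1) by (simp add: powr_powr)
      \<comment> \<open>Here T < N + 1 \<le> 2 N; the resulting factor 2^e is at most 2 because e <
        1.\<close>
      also have "\<dots> < (2 * real N) powr e"
        using NT(2) N T0 e(1) by (intro powr_less_mono2) auto
      also have "\<dots> = 2 powr e * real N powr e"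
        by (simp add: powr_mult)
      also have "\<dots> \<le> 2 * real N powr e"
        using e(4) powr_mono[of e 1 2] by (intro mult_right_mono) auto
      finally have "D < \<epsilon>\<^sup>2 * (2 * real N powr e)"
        using \<epsilon> by (simp add: field_simps)
      moreover have "\<epsilon>\<^sup>2 * real N powr e \<le> D\<^sub>0"
      proof -
        have "(\<epsilon>\<^sup>2 * real N powr e) * real N powr (\<gamma> - e) = \<epsilon>\<^sup>2 * real N powr \<gamma>"
          by (simp flip: powr_add)
        also have "\<dots> \<le> \<epsilon>\<^sup>2 * (\<Sum>n=1..N. real n powr (\<gamma> - 1))"
          using powr_sum_ge[OF \<gamma>(2)] by (intro mult_left_mono) auto
        also have "\<dots> \<le> D\<^sub>0 * real N powr (\<gamma> - e)"
          using \<epsilon> big e N by (intro sum_le) auto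
        finally show ?thesis
          using N by simp
      qed
      ultimately show False
        using D(2) by simp
    qed
  qed
  with D(1) show thesis using that by blast
qed

section \<open>Two-sided covariance bounds for power-law step sizes\<close>

text \<open>Since \<gamma> \<ge> 0, the factor 1 / (1 + n^(\<gamma>-1)) is at most (1 + 1/n)^-1,
  which p \<ge> -1 bounds by (1 + 1/n)^p. For the covariance rate, p \<ge> -1 is the condition
  \<beta> \<le> \<gamma>.\<close>

lemma powr_Suc_ge:
  assumes p: "- 1 \<le> p" and \<gamma>: "0 \<le> \<gamma>" and n: "n \<ge> 1"
  shows "real n powr p / (1 + real n powr (\<gamma> - 1)) \<le> real (Suc n) powr p"
proof -
  have "real n powr (- 1) \<le> real n powr (\<gamma> - 1)"
    using \<gamma> n by (intro powr_mono) auto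
  then have le: "1 + 1 / real n \<le> 1 + real n powr (\<gamma> - 1)"
    using n by (simp add: powr_minus_divide)
  have "1 / (1 + real n powr (\<gamma> - 1)) \<le> 1 / (1 + 1 / real n)"
    using le n by (intro divide_left_mono) (auto intro!: mult_pos_pos add_pos_nonneg)
  also have "\<dots> = (1 + 1 / real n) powr (- 1)"
    using n by (simp add: powr_minus_divide add_pos_nonneg)
  also have "\<dots> \<le> (1 + 1 / real n) powr p"
    using p n by (intro powr_mono) auto
  finally have "real n powr p * (1 / (1 + real n powr (\<gamma> - 1))) \<le> real n powr p * (1 + 1 / real n) powr p"
    by (intro mult_left_mono) auto
  also have "\<dots> = (real n * (1 + 1 / real n)) powr p"
    using n by (simp add: powr_mult)
  also have "real n * (1 + 1 / real n) = real (Suc n)"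
    using n by (simp add: field_simps)
  finally show ?thesis by simp
qed

text \<open>With x = n^(\<gamma>-1), the contraction factor is 1 / (1 + h A x) and the inflation is
  r n^p x. By \<open>powr_Suc_ge\<close> it suffices to stay below A n^p / (1 + x), so the gap
  between A / (1 + x) and A / (1 + h A x) must pay for r x.\<close>

lemma covariance_recursion_upper:
  assumes h: "h > 0" and r: "0 \<le> r" and A: "6 * r \<le> A" "2 \<le> h * A"
    and \<gamma>: "0 \<le> \<gamma>" "\<gamma> \<le> 1" and \<beta>: "\<beta> \<le> \<gamma>" and n: "n \<ge> 1"
  defines "p \<equiv> \<gamma> - \<beta> - 1"
  shows "A * real n powr p / (1 + h * real n powr \<beta> * (A * real n powr p)) + r * real n powr (2 * \<gamma> - \<beta> - 2)
    \<le> A * real (Suc n) powr p"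
proof -
  define x where "x = real n powr (\<gamma> - 1)"
  have x: "0 < x" "x \<le> 1"
    using n \<gamma> powr_mono[of "\<gamma> - 1" 0 "real n"] by (auto simp: x_def)
  have A0: "A \<ge> 0"
    using A(1) r by simp
  have 1: "real n powr \<beta> * real n powr p = x" "real n powr (2 * \<gamma> - \<beta> - 2) = real n powr p * x"
    by (simp_all add: x_def p_def algebra_simps flip: powr_add)
  have hx: "1 + h * A * x > 0"
    using h A0 x by (simp add: add_pos_nonneg)
  have "r * x \<le> A / (1 + x) - A / (1 + h * A * x)"
  proof -
    have "h * A * x \<le> h * A"
      using mult_left_le[of x "h * A"] x A(2) by simp
    \<comment> \<open>From x \<le> 1 and h A \<ge> 2 the product is at most 6 (h A - 1); this is the
      origin of the condition 6 r \<le> A.\<close>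
    then have "(1 + x) * (1 + h * A * x) \<le> 2 * (1 + h * A)"
      using x hx by (intro mult_mono) auto
    also have "\<dots> \<le> 6 * (h * A - 1)"
      using A(2) by (simp add: mult.commute)
    finally have "r * ((1 + x) * (1 + h * A * x)) \<le> r * (6 * (h * A - 1))"
      using r by (rule mult_left_mono)
    also have "\<dots> \<le> A * (h * A - 1)"
      using mult_right_mono[OF A(1), of "h * A - 1"] A(2) by (simp add: mult_ac)
    finally have "r \<le> A * (h * A - 1) / ((1 + x) * (1 + h * A * x))"
      using x hx by (simp add: pos_le_divide_eq)
    then have "r * x \<le> A * (h * A - 1) / ((1 + x) * (1 + h * A * x)) * x"
      using x by (intro mult_right_mono) auto
    also have "\<dots> = A / (1 + x) - A / (1 + h * A * x)"
      using x hx by (simp add: diff_frac_eq) (simp add: algebra_simps)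
    finally show ?thesis .
  qed
  then have "real n powr p * (A / (1 + h * A * x) + r * x) \<le> real n powr p * (A / (1 + x))"
    by (intro mult_left_mono) auto
  also have "\<dots> = A * (real n powr p / (1 + x))"
    by simp
  also have "\<dots> \<le> A * real (Suc n) powr p"
    unfolding x_def using \<gamma> \<beta> n A0 by (intro mult_left_mono powr_Suc_ge) (auto simp: p_def)
  finally show ?thesis
    using 1 by (simp add: algebra_simps)
qed

text \<open>Contraction costs at most the fraction B x, because 1 / (1 + B x) \<ge> 1 - B x, and the
  inflation r x compensates this loss when a B \<le> r. As p \<le> 0, the target does not grow with
  n.\<close>

lemma covariance_recursion_lower:
  assumes B: "0 \<le> B" and a: "0 \<le> a" "a * B \<le> r" and \<gamma>: "\<gamma> - 1 \<le> \<beta>" and n: "n \<ge> 1"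
  defines "p \<equiv> \<gamma> - \<beta> - 1"
  shows "a * real (Suc n) powr p
    \<le> 1 / (1 + B * real n powr (\<gamma> - 1)) * (a * real n powr p) + r * real n powr (2 * \<gamma> - \<beta> - 2)"
proof -
  define x where "x = real n powr (\<gamma> - 1)"
  have x: "0 \<le> x"
    by (simp add: x_def)
  have 1: "real n powr (2 * \<gamma> - \<beta> - 2) = real n powr p * x"
    by (simp add: x_def p_def algebra_simps flip: powr_add)
  have "(1 - B * x) * (1 + B * x) \<le> 1"
    using zero_le_power2[of "B * x"] by (simp add: algebra_simps power2_eq_square)
  then have "1 - B * x \<le> 1 / (1 + B * x)"
    using B x by (simp add: pos_le_divide_eq add_pos_nonneg)
  then have "(1 - B * x) * a + r * x \<le> 1 / (1 + B * x) * a + r * x"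
    using a by (intro add_right_mono mult_right_mono) auto
  moreover have "a \<le> (1 - B * x) * a + r * x"
    using mult_right_mono[OF a(2) x] by (simp add: algebra_simps)
  ultimately have "real n powr p * a \<le> real n powr p * (1 / (1 + B * x) * a + r * x)"
    by (intro mult_left_mono) auto
  moreover have "a * real (Suc n) powr p \<le> a * real n powr p"
    using a \<gamma> n by (intro mult_left_mono powr_mono2') (auto simp: p_def)
  ultimately show ?thesis
    unfolding 1 x_def[symmetric] by (simp add: algebra_simps)
qed

section \<open>Covariance rates and eventual descent along the iteration\<close>

locale EKI_power_steps = smooth_EKI G y \<Gamma> \<Sigma> H' H'' M\<^sub>1 M\<^sub>2 K h \<alpha> u
  for G :: "real ^ 'u \<Rightarrow> real ^ 'y" and y \<Gamma> \<Sigma> H' H'' M\<^sub>1 M\<^sub>2 K h \<alpha> u +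
  fixes \<beta> \<gamma> :: real
  assumes h_eq: "\<And>n. n \<ge> 1 \<Longrightarrow> h n = h 0 * real n powr \<beta>"
    and \<alpha>_eq: "\<And>n. n \<ge> 1 \<Longrightarrow> (\<alpha> n)\<^sup>2 = (\<alpha> 0)\<^sup>2 / h 0 * real n powr (2 * \<gamma> - \<beta> - 2)"
    and \<beta>: "\<gamma> - 1 < \<beta>" "\<beta> \<le> \<gamma>" and \<gamma>: "0 \<le> \<gamma>" "\<gamma> < 1"
begin

abbreviation "rate \<equiv> \<gamma> - \<beta> - 1"

lemma step_size_powr: "n \<ge> 1 \<Longrightarrow> h n * (c * real n powr rate) = h 0 * c * real n powr (\<gamma> - 1)"
  by (simp add: h_eq flip: powr_add)

text \<open>A crude bound that starts the inductions: used at n = 1 for the upper covariance bound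
  and at n = 0 for the lower one.\<close>

lemma deviation_bounded:
  obtains \<tau> where "0 \<le> \<tau>" and "\<And>i. i \<in> {1..K} \<Longrightarrow> norm (deviation K (u n) i) \<le> \<tau>"
proof (rule that)
  show "0 \<le> (\<Sum>i=1..K. norm (deviation K (u n) i))"
    by (simp add: sum_nonneg)
  show "norm (deviation K (u n) i) \<le> (\<Sum>i=1..K. norm (deviation K (u n) i))" if "i \<in> {1..K}" for i
    using that by (intro member_le_sum) auto
qed

lemma cov_upper:
  obtains A where "A > 0" and
    "\<And>n v. n \<ge> 1 \<Longrightarrow> v \<bullet> (cov n *v v) \<le> A * real n powr rate * (v \<bullet> (\<Sigma> *v v))"
proof -
  obtain \<sigma> where \<sigma>: "\<sigma> > 0" "\<And>v. \<sigma> * (norm v)\<^sup>2 \<le> v \<bullet> (\<Sigma> *v v)"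
    using sym_pos_def_coercive[OF pd_\<Sigma>] by blast
  obtain \<tau> where \<tau>: "0 \<le> \<tau>" "\<And>i. i \<in> {1..K} \<Longrightarrow> norm (deviation K (u 1) i) \<le> \<tau>"
    using deviation_bounded by blast
  define r where "r = (\<alpha> 0)\<^sup>2 / h 0"
  \<comment> \<open>The first two summands meet the conditions of
    \<open>covariance_recursion_upper\<close>. The last covers n = 1, where the induction starts
    because the power laws hold only from there on.\<close>
  define A where "A = 6 * r + 2 / h 0 + \<tau>\<^sup>2 / \<sigma>"
  have h0: "h 0 > 0" and r: "0 \<le> r" and t: "0 \<le> \<tau>\<^sup>2 / \<sigma>"
    using h_pos[of 0] \<sigma>(1) by (simp_all add: r_def)
  have A: "A > 0" "6 * r \<le> A" "2 \<le> h 0 * A" "\<tau>\<^sup>2 / \<sigma> \<le> A"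
  proof -
    show "A > 0" "6 * r \<le> A" "\<tau>\<^sup>2 / \<sigma> \<le> A"
      using h0 r t by (auto simp: A_def add_nonneg_pos add_pos_nonneg)
    have "2 / h 0 \<le> A"
      using r t by (simp add: A_def)
    then show "2 \<le> h 0 * A"
      using h0 by (simp add: field_simps)
  qed
  have "v \<bullet> (cov n *v v) \<le> A * real n powr rate * (v \<bullet> (\<Sigma> *v v))" if "n \<ge> 1" for n v
    using that
  proof (induction n arbitrary: v rule: dec_induct)
    case base
    have "v \<bullet> (cov 1 *v v) \<le> \<tau>\<^sup>2 * (norm v)\<^sup>2"
      by (rule inner_ens_cov_le[OF K \<tau>(2)])
    also have "\<dots> = (\<tau>\<^sup>2 / \<sigma>) * (\<sigma> * (norm v)\<^sup>2)"
      using \<sigma>(1) by simp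
    also have "\<dots> \<le> A * (v \<bullet> (\<Sigma> *v v))"
      using A \<sigma> by (intro mult_mono) auto
    finally show ?case by simp
  next
    case (step n)
    have n: "n \<ge> 1" using step by simp
    have "v \<bullet> (cov (Suc n) *v v) \<le> (A * real n powr rate / (1 + h n * (A * real n powr rate)) + (\<alpha> n)\<^sup>2)
        * (v \<bullet> (\<Sigma> *v v))"
      using A(1) by (intro EKI_cov_upper[OF EKI pd_\<Gamma> pd_\<Sigma>] step.IH) auto
    also have "\<dots> \<le> (A * real (Suc n) powr rate) * (v \<bullet> (\<Sigma> *v v))"
      using covariance_recursion_upper[OF h0 r A(2,3) \<gamma>(1) less_imp_le[OF \<gamma>(2)] \<beta>(2) n]
      unfolding h_eq[OF n] \<alpha>_eq[OF n] r_def
      by (intro mult_right_mono sym_pos_def_nonneg[OF pd_\<Sigma>])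
    finally show ?case .
  qed
  with A(1) show thesis using that by blast
qed

lemma deviation_upper:
  obtains T where "T > 0" and
    "\<And>n i. \<lbrakk>n \<ge> 1; i \<in> {1..K}\<rbrakk> \<Longrightarrow> norm (deviation K (u n) i) \<le> sqrt (T * real n powr rate)"
proof -
  obtain A where A: "A > 0" "\<And>n v. n \<ge> 1 \<Longrightarrow> v \<bullet> (cov n *v v) \<le> A * real n powr rate * (v \<bullet> (\<Sigma> *v v))"
    using cov_upper by blast
  obtain b where b: "b > 0" "\<And>v. norm (\<Sigma> *v v) \<le> b * norm v"
    using matrix_mult_vec_bounded by blast
  have "v \<bullet> (cov n *v v) \<le> (A * b * real n powr rate) * (norm v)\<^sup>2" if n: "n \<ge> 1" for n v
  proof -
    have "v \<bullet> (\<Sigma> *v v) \<le> b * (norm v)\<^sup>2"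
      using norm_cauchy_schwarz[of v "\<Sigma> *v v"] mult_left_mono[OF b(2)[of v], of "norm v"]
      by (simp add: power2_eq_square mult_ac)
    then have "A * real n powr rate * (v \<bullet> (\<Sigma> *v v)) \<le> A * real n powr rate * (b * (norm v)\<^sup>2)"
      using A(1) by (intro mult_left_mono) auto
    then show ?thesis
      using A(2)[OF n, of v] by (simp add: mult_ac)
  qed
  note norm_deviation_le_ens_cov[OF K _ this]
  moreover have "real K * (A * b * real n powr rate) = (real K * A * b) * real n powr rate" for n
    by simp
  moreover have "real K * A * b > 0"
    using K A(1) b(1) by simp
  ultimately show thesis
    using that[of "real K * A * b"] by metis
qed

lemma obs_cov_le:
  assumes dev: "\<And>i. i \<in> {1..K} \<Longrightarrow> norm (deviation K (u n) i) \<le> \<tau>"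
    and \<sigma>: "\<sigma> > 0" "\<And>v. \<sigma> * (norm v)\<^sup>2 \<le> v \<bullet> (B *v v)"
  shows "x \<bullet> (obs_cov n *v x) \<le> 4 * M\<^sub>1\<^sup>2 / \<sigma> * \<tau>\<^sup>2 * (x \<bullet> (B *v x))"
proof -
  have "x \<bullet> (obs_cov n *v x) \<le> (2 * (M\<^sub>1 * \<tau>))\<^sup>2 * (norm x)\<^sup>2"
    by (rule inner_ens_cov_le[OF K norm_deviation_obs_le[OF dev]])
  also have "\<dots> = 4 * M\<^sub>1\<^sup>2 / \<sigma> * \<tau>\<^sup>2 * (\<sigma> * (norm x)\<^sup>2)"
    using \<sigma>(1) by (simp add: power_mult_distrib)
  also have "\<dots> \<le> 4 * M\<^sub>1\<^sup>2 / \<sigma> * \<tau>\<^sup>2 * (x \<bullet> (B *v x))"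
    using \<sigma> by (intro mult_left_mono) auto
  finally show ?thesis .
qed

text \<open>The upper bound on the deviations limits C^pp through the Lipschitz bound, and thereby
  the contraction in each step to what the inflation can compensate.\<close>

lemma cov_lower:
  obtains a where "a > 0" and
    "\<And>n v. n \<ge> 1 \<Longrightarrow> a * real n powr rate * (v \<bullet> (\<Sigma> *v v)) \<le> v \<bullet> (cov n *v v)"
proof -
  obtain \<sigma> where \<sigma>: "\<sigma> > 0" "\<And>v. \<sigma> * (norm v)\<^sup>2 \<le> v \<bullet> (B *v v)"
    using sym_pos_def_coercive[OF pd_B] by blast
  obtain \<tau> where \<tau>: "0 \<le> \<tau>" "\<And>i. i \<in> {1..K} \<Longrightarrow> norm (deviation K (u 0) i) \<le> \<tau>"
    using deviation_bounded by blast
  obtain T where T: "T > 0"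
      "\<And>n i. \<lbrakk>n \<ge> 1; i \<in> {1..K}\<rbrakk> \<Longrightarrow> norm (deviation K (u n) i) \<le> sqrt (T * real n powr rate)"
    using deviation_upper by blast
  define r where "r = (\<alpha> 0)\<^sup>2 / h 0"
  define s where "s = 4 * M\<^sub>1\<^sup>2 / \<sigma> * T + 1"
  \<comment> \<open>The first entry serves n = 1, where the inflation of step 0 alone contributes
    \<open>(\<alpha> 0)\<^sup>2\<close> times \<Sigma>, even for a degenerate initial ensemble. The
    second is the condition of \<open>covariance_recursion_lower\<close>.\<close>
  define a where "a = min ((\<alpha> 0)\<^sup>2) (r / (h 0 * s))"
  have h0: "h 0 > 0" by (rule h_pos)
  have s: "s > 0"
    using \<sigma>(1) T(1) by (simp add: s_def add_nonneg_pos)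
  have a: "a > 0" "a \<le> (\<alpha> 0)\<^sup>2" "a * (h 0 * s) \<le> r"
  proof -
    show "a > 0" "a \<le> (\<alpha> 0)\<^sup>2"
      using h0 s \<alpha>_pos[of 0] by (simp_all add: a_def r_def)
    have "a \<le> r / (h 0 * s)"
      by (simp add: a_def)
    then show "a * (h 0 * s) \<le> r"
      using h0 s by (simp add: pos_le_divide_eq)
  qed
  have "a * real n powr rate * (v \<bullet> (\<Sigma> *v v)) \<le> v \<bullet> (cov n *v v)" if "n \<ge> 1" for n v
    using that
  proof (induction n arbitrary: v rule: dec_induct)
    case base
    define s\<^sub>0 where "s\<^sub>0 = 4 * M\<^sub>1\<^sup>2 / \<sigma> * \<tau>\<^sup>2 + 1"
    have s0: "s\<^sub>0 > 0"
      using \<sigma>(1) by (simp add: s\<^sub>0_def add_nonneg_pos)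
    have "x \<bullet> (obs_cov 0 *v x) \<le> s\<^sub>0 * (x \<bullet> (B *v x))" for x
      using obs_cov_le[OF \<tau>(2) \<sigma>, of x] sym_pos_def_nonneg[OF pd_B, of x]
      by (simp add: s\<^sub>0_def algebra_simps)
    from EKI_cov_lower[OF EKI pd_\<Gamma> pd_\<Sigma> s0 this, of v]
    have "1 / (1 + h 0 * s\<^sub>0) * (v \<bullet> (cov 0 *v v)) + (\<alpha> 0)\<^sup>2 * (v \<bullet> (\<Sigma> *v v)) \<le> v \<bullet> (cov 1 *v v)"
      by simp
    moreover have "0 \<le> 1 / (1 + h 0 * s\<^sub>0) * (v \<bullet> (cov 0 *v v))"
      using h0 s0 by (intro mult_nonneg_nonneg ens_cov_nonneg) auto
    moreover have "a * (v \<bullet> (\<Sigma> *v v)) \<le> (\<alpha> 0)\<^sup>2 * (v \<bullet> (\<Sigma> *v v))"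
      using a by (intro mult_right_mono sym_pos_def_nonneg[OF pd_\<Sigma>])
    ultimately show ?case by simp
  next
    case (step n)
    have n: "n \<ge> 1" using step by simp
    define x where "x = real n powr rate"
    have x: "x > 0"
      using n by (simp add: x_def)
    have sx: "s * x > 0"
      using s x by simp
    have le: "w \<bullet> (obs_cov n *v w) \<le> (s * x) * (w \<bullet> (B *v w))" for w
    proof -
      have "w \<bullet> (obs_cov n *v w) \<le> 4 * M\<^sub>1\<^sup>2 / \<sigma> * (sqrt (T * x))\<^sup>2 * (w \<bullet> (B *v w))"
        unfolding x_def by (rule obs_cov_le[OF T(2)[OF n] \<sigma>])
      also have "\<dots> \<le> (s * x) * (w \<bullet> (B *v w))"
        using T(1) x by (intro mult_right_mono sym_pos_def_nonneg[OF pd_B]) (simp add: s_def algebra_simps)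
      finally show ?thesis .
    qed
    have hx: "h n * (s * x) = h 0 * s * real n powr (\<gamma> - 1)"
      unfolding x_def by (rule step_size_powr[OF n])
    have \<gamma>\<beta>: "\<gamma> - 1 \<le> \<beta>"
      using \<beta> by simp
    have "a * real (Suc n) powr rate * (v \<bullet> (\<Sigma> *v v))
        \<le> (1 / (1 + h n * (s * x)) * (a * x) + (\<alpha> n)\<^sup>2) * (v \<bullet> (\<Sigma> *v v))"
      unfolding hx unfolding \<alpha>_eq[OF n] x_def r_def[symmetric]
      using h0 s a by (intro mult_right_mono covariance_recursion_lower \<gamma>\<beta> n sym_pos_def_nonneg[OF pd_\<Sigma>]) auto
    also have "\<dots> = 1 / (1 + h n * (s * x)) * (a * x * (v \<bullet> (\<Sigma> *v v))) + (\<alpha> n)\<^sup>2 * (v \<bullet> (\<Sigma> *v v))"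
      by (simp add: distrib_right)
    also have "\<dots> \<le> 1 / (1 + h n * (s * x)) * (v \<bullet> (cov n *v v)) + (\<alpha> n)\<^sup>2 * (v \<bullet> (\<Sigma> *v v))"
      using step.IH[of v] h_pos[of n] sx unfolding x_def
      by (intro add_right_mono mult_left_mono) (auto intro!: divide_nonneg_nonneg add_nonneg_nonneg)
    also have "\<dots> \<le> v \<bullet> (cov (Suc n) *v v)"
      by (rule EKI_cov_lower[OF EKI pd_\<Gamma> pd_\<Sigma> sx le])
    finally show ?case .
  qed
  with a(1) show thesis using that by blast
qed

lemma eventual_descent:
  obtains \<kappa> E n\<^sub>0 where "\<kappa> > 0" and "E \<ge> 0" and
    "\<And>n. n \<ge> n\<^sub>0 \<Longrightarrow> \<kappa> * real n powr (\<gamma> - 1) * (norm (gradient objective (mean n)))\<^sup>2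
      \<le> objective (mean n) - objective (mean (Suc n)) + E * real n powr (2 * \<gamma> - \<beta> - 2)"
proof -
  obtain T where T: "T > 0"
      "\<And>n i. \<lbrakk>n \<ge> 1; i \<in> {1..K}\<rbrakk> \<Longrightarrow> norm (deviation K (u n) i) \<le> sqrt (T * real n powr rate)"
    using deviation_upper by blast
  obtain a where a: "a > 0"
      "\<And>n v. n \<ge> 1 \<Longrightarrow> a * real n powr rate * (v \<bullet> (\<Sigma> *v v)) \<le> v \<bullet> (cov n *v v)"
    using cov_lower by blast
  obtain \<sigma> where \<sigma>: "\<sigma> > 0" "\<And>v. \<sigma> * (norm v)\<^sup>2 \<le> v \<bullet> (\<Sigma> *v v)"
    using sym_pos_def_coercive[OF pd_\<Sigma>] by blast
  \<comment> \<open>The ratio of the lower covariance bound to \<tau>^2 = T n^p; the powers of n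
    cancel, so it is the same for all n.\<close>
  define l where "l = a * \<sigma> / T"
  have l: "l > 0"
    using a \<sigma> T by (simp add: l_def)
  obtain c where c: "c \<ge> 1" and descent:
    "\<And>n l \<tau>. \<lbrakk>l > 0; 0 \<le> \<tau>; \<And>i. i \<in> {1..K} \<Longrightarrow> norm (deviation K (u n) i) \<le> \<tau>;
        \<And>w. l * \<tau>\<^sup>2 * (norm w)\<^sup>2 \<le> w \<bullet> (cov n *v w); h n * \<tau>\<^sup>2 \<le> 1; h n * \<tau>\<^sup>2 \<le> l / (4 * c)\<rbrakk> \<Longrightarrow>
      l / (2 * (2 + c)\<^sup>2) * (h n * \<tau>\<^sup>2) * (norm (gradient objective (mean n)))\<^sup>2
      \<le> objective (mean n) - objective (mean (Suc n))
        + (c\<^sup>2 + 2 * c ^ 3 + 2 * c\<^sup>2 / l + 2 * (l / (2 * (2 + c)\<^sup>2)) * (c\<^sup>2 + c)\<^sup>2) * (h n * \<tau>\<^sup>2) * \<tau>\<^sup>2"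
    using objective_descent by blast
  define k where "k = l / (2 * (2 + c)\<^sup>2)"
  define e where "e = c\<^sup>2 + 2 * c ^ 3 + 2 * c\<^sup>2 / l + 2 * k * (c\<^sup>2 + c)\<^sup>2"
  have k: "k > 0" and e: "e \<ge> 0"
    using l c by (simp_all add: k_def e_def)
  have h0: "h 0 > 0" by (rule h_pos)
  \<comment> \<open>Since \<gamma> < 1, the quantity h \<tau>^2 tends to 0, so both smallness
    conditions hold from some index on.\<close>
  have "(\<lambda>n. h 0 * T * real n powr (\<gamma> - 1)) \<longlonglongrightarrow> h 0 * T * 0"
    using \<gamma>(2) by (intro tendsto_intros tendsto_neg_powr filterlim_real_sequentially) auto
  moreover have "0 < min 1 (l / (4 * c))"
    using l c by simp
  ultimately have "eventually (\<lambda>n. h 0 * T * real n powr (\<gamma> - 1) < min 1 (l / (4 * c))) sequentially"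
    by (intro order_tendstoD(2)) auto
  then obtain n\<^sub>0 where n0: "\<And>n. n \<ge> n\<^sub>0 \<Longrightarrow> h 0 * T * real n powr (\<gamma> - 1) < min 1 (l / (4 * c))"
    unfolding eventually_sequentially by blast
  \<comment> \<open>The factors come from h \<tau>^2 = h_0 T n^(\<gamma>-1), with one more \<tau>^2
    = T n^p in the error term. The maximum with 1 ensures that the power laws apply.\<close>
  show thesis
  proof (rule that[of "k * (h 0 * T)" "e * (h 0 * T * T)" "max 1 n\<^sub>0"])
    show "k * (h 0 * T) > 0" "e * (h 0 * T * T) \<ge> 0"
      using k e h0 T(1) by simp_all
    fix n assume "n \<ge> max 1 n\<^sub>0"
    then have n: "n \<ge> 1" and "n \<ge> n\<^sub>0" by simp_all
    let ?\<tau> = "sqrt (T * real n powr rate)"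
    have \<tau>: "?\<tau>\<^sup>2 = T * real n powr rate"
      using T(1) by simp
    have h\<tau>: "h n * ?\<tau>\<^sup>2 = h 0 * T * real n powr (\<gamma> - 1)"
      unfolding \<tau> by (rule step_size_powr[OF n])
    have low: "l * ?\<tau>\<^sup>2 * (norm w)\<^sup>2 \<le> w \<bullet> (cov n *v w)" for w
    proof -
      have "l * ?\<tau>\<^sup>2 * (norm w)\<^sup>2 = a * real n powr rate * (\<sigma> * (norm w)\<^sup>2)"
        using T(1) unfolding \<tau> by (simp add: l_def)
      also have "\<dots> \<le> a * real n powr rate * (w \<bullet> (\<Sigma> *v w))"
        using a(1) \<sigma> by (intro mult_left_mono) auto
      finally show ?thesis
        using a(2)[OF n, of w] by simp
    qed
    have "0 \<le> ?\<tau>" "h n * ?\<tau>\<^sup>2 \<le> 1" "h n * ?\<tau>\<^sup>2 \<le> l / (4 * c)"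
      unfolding h\<tau> using n0[OF \<open>n \<ge> n\<^sub>0\<close>] T(1) by simp_all
    from descent[OF l this(1) T(2)[OF n] low this(2,3)]
    have "k * (h n * ?\<tau>\<^sup>2) * (norm (gradient objective (mean n)))\<^sup>2
        \<le> objective (mean n) - objective (mean (Suc n)) + e * (h n * ?\<tau>\<^sup>2) * ?\<tau>\<^sup>2"
      by (simp only: k_def e_def)
    moreover have "e * (h n * ?\<tau>\<^sup>2) * ?\<tau>\<^sup>2 = e * (h 0 * T * T) * real n powr (2 * \<gamma> - \<beta> - 2)"
    proof -
      have "real n powr (2 * \<gamma> - \<beta> - 2) = real n powr (\<gamma> - 1) * real n powr rate"
        by (simp add: algebra_simps flip: powr_add)
      then show ?thesis
        unfolding h\<tau> unfolding \<tau> by simp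
    qed
    moreover have "k * (h n * ?\<tau>\<^sup>2) = k * (h 0 * T) * real n powr (\<gamma> - 1)"
      unfolding h\<tau> by simp
    ultimately show "k * (h 0 * T) * real n powr (\<gamma> - 1) * (norm (gradient objective (mean n)))\<^sup>2
      \<le> objective (mean n) - objective (mean (Suc n)) + e * (h 0 * T * T) * real n powr (2 * \<gamma> - \<beta> - 2)"
      by (simp only:)
  qed
qed

lemma gradient_complexity:
  obtains D where "D > 0" and
    "\<And>\<epsilon>. \<epsilon> > 0 \<Longrightarrow> \<exists>n. real n \<le> threshold_iteration \<beta> \<gamma> D \<epsilon> \<and> norm (gradient objective (mean n)) \<le> \<epsilon>"
proof -
  obtain \<kappa> E n\<^sub>0 where *: "\<kappa> > 0" "E \<ge> 0"
    "\<And>n. n \<ge> n\<^sub>0 \<Longrightarrow> \<kappa> * real n powr (\<gamma> - 1) * (norm (gradient objective (mean n)))\<^sup>2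
      \<le> objective (mean n) - objective (mean (Suc n)) + E * real n powr (2 * \<gamma> - \<beta> - 2)"
    using eventual_descent by blast
  show thesis
    using iteration_complexity[OF *(1,2) objective_nonneg norm_ge_zero \<gamma> \<beta>(1) *(3)] that by blast
qed

end

theorem theorem3p7:
  fixes G :: "real ^ 'u \<Rightarrow> real ^ 'y"
    and y :: "real ^ 'y"
    and \<Gamma> :: "real ^ 'y ^ 'y"
    and \<Sigma> :: "real ^ 'u ^ 'u"
    and H' :: "real ^ 'u \<Rightarrow> (real ^ 'u) \<Rightarrow>\<^sub>L (real ^ ('y + 'u))"
    and H'' :: "real ^ 'u \<Rightarrow> (real ^ 'u) \<Rightarrow>\<^sub>L ((real ^ 'u) \<Rightarrow>\<^sub>L (real ^ ('y + 'u)))"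
    and M\<^sub>1 M\<^sub>2 \<beta> \<gamma> :: real
    and K :: nat
    and h \<alpha> :: "nat \<Rightarrow> real"
    and u :: "nat \<Rightarrow> nat \<Rightarrow> real ^ 'u"
  assumes "sym_pos_def \<Gamma>" and "sym_pos_def \<Sigma>"
    and "\<And>x. (augmented G has_derivative blinfun_apply (H' x)) (at x)"
    and "\<And>x. (H' has_derivative blinfun_apply (H'' x)) (at x)"
    and "\<And>x. norm (H' x) \<le> M\<^sub>1"
    and "\<And>x x'. norm (augmented G x' - augmented G x) \<le> M\<^sub>1 * norm (x' - x)"
    and "\<And>x v. norm (blinfun_apply (blinfun_apply (H'' x) v) v) \<le> M\<^sub>2 * (norm v)\<^sup>2"
    and "K \<ge> 1"
    and "EKI_sequence G y \<Gamma> \<Sigma> K h \<alpha> u"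
    and "\<And>n. n \<ge> 1 \<Longrightarrow> h n = h 0 * real n powr \<beta>"
    and "\<And>n. n \<ge> 1 \<Longrightarrow> (\<alpha> n)\<^sup>2 = (\<alpha> 0)\<^sup>2 / h 0 * real n powr (2 * \<gamma> - \<beta> - 2)"
    and "\<gamma> - 1 < \<beta>" and "\<beta> \<le> \<gamma>" and "0 \<le> \<gamma>" and "\<gamma> < 1"
    and "bounded (range (\<lambda>n. ens_mean K (u n)))"
  shows "\<exists>D>0. \<forall>\<epsilon>>0.
           (MIN n\<in>{n. real n \<le> threshold_iteration \<beta> \<gamma> D \<epsilon>}.
              norm (gradient (loss G y \<Gamma> \<Sigma>) (ens_mean K (u n)))) \<le> \<epsilon>"
proof -
  interpret EKI_power_steps G y \<Gamma> \<Sigma> H' H'' M\<^sub>1 M\<^sub>2 K h \<alpha> u \<beta> \<gamma>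
    by unfold_locales (fact assms)+
  obtain D where D: "D > 0" "\<And>\<epsilon>. \<epsilon> > 0 \<Longrightarrow>
      \<exists>n. real n \<le> threshold_iteration \<beta> \<gamma> D \<epsilon> \<and> norm (gradient objective (mean n)) \<le> \<epsilon>"
    using gradient_complexity by blast
  have "(MIN n\<in>{n. real n \<le> threshold_iteration \<beta> \<gamma> D \<epsilon>}. norm (gradient objective (mean n))) \<le> \<epsilon>"
    if \<epsilon>: "\<epsilon> > 0" for \<epsilon>
  proof -
    \<comment> \<open>The minimum is meaningful only over a finite nonempty set: the floor of the
      threshold bounds the indices, and the index from \<open>gradient_complexity\<close> belongs to
      the set.\<close>
    have "{n. real n \<le> threshold_iteration \<beta> \<gamma> D \<epsilon>} \<subseteq> {..nat \<lfloor>threshold_iteration \<beta> \<gamma> D \<epsilon>\<rfloor>}"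
      by (auto simp: le_nat_floor)
    then have "finite {n. real n \<le> threshold_iteration \<beta> \<gamma> D \<epsilon>}"
      by (rule finite_subset) simp
    then show ?thesis
      using D(2)[OF \<epsilon>] by (auto intro: Min_le order_trans)
  qed
  with D(1) show ?thesis by blast
qed

end
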